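(* Let $0<m<n$ be integers, let $\mu$ be a finite Borel measure on $\mathbb{R}^n$ and let $\Sigma\subset\mathrm{Gr}(n,m)$ be a Borel set. Then one of the following two alternatives holds (not necessarily exclusively): (1) for $\gamma_{n,m}$-a.e. $V\in\Sigma$, the projection $\pi_V\colon\mathbb{R}^n\to V$ is injective on a set of full $\mu$-measure; (2) $\gamma_{n,m}\bigl(\{V\in\Sigma : (\pi_V\mu)^a\neq 0\}\bigr)>0$.
   Context: $\mathrm{Gr}(n,m)$ is the Grassmannian of $m$-dimensional linear subspaces of $\mathbb{R}^n$, $\gamma_{n,m}$ is the orthogonally invariant measure on it, $\pi_V\colon\mathbb{R}^n\to V$ is the orthogonal projection, $\pi_V\mu(B)=\mu(\pi_V^{-1}(B))$ is the push-forward, and $(\pi_V\mu)^a$ is the absolutely continuous part of $\pi_V\mu$ with respect to the $m$-dimensional Hausdorff measure $\mathcal{H}^m$ on $V$. *)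

theory Defs
  imports "HOL-Probability.Probability"
begin

section \<open>Orthogonal projections and the Grassmannian\<close>

definition orth_proj :: "'a::euclidean_space set \<Rightarrow> 'a \<Rightarrow> 'a" where
  "orth_proj V x = (THE v. v \<in> V \<and> (\<forall>w\<in>V. orthogonal (x - v) w))"

definition grassmannian :: "nat \<Rightarrow> 'a::euclidean_space set set" where
  "grassmannian m = {V. subspace V \<and> dim V = m}"

text \<open>The norm below is the operator norm, so this is the usual metric
  \<open>\<parallel>\<pi>\<^sub>V - \<pi>\<^sub>W\<parallel>\<close> on the Grassmannian. Going through the type of bounded linear maps
  makes it symmetric and nonnegative also on arguments that are not subspaces.\<close>

definition grass_dist :: "'a::euclidean_space set \<Rightarrow> 'a set \<Rightarrow> real" where
  "grass_dist V W = norm (Blinfun (orth_proj V) - Blinfun (orth_proj W))"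

definition grass_borel :: "nat \<Rightarrow> 'a::euclidean_space set measure" where
  "grass_borel m =
     sigma (grassmannian m) {U. openin (Metric_space.mtopology (grassmannian m) grass_dist) U}"

text \<open>The orthogonally invariant measure on the Grassmannian, normalised to be a probability
  measure; for \<open>m \<le> DIM('a)\<close> there is exactly one measure with this property.\<close>

definition grass_invariant_measure :: "nat \<Rightarrow> 'a::euclidean_space set measure \<Rightarrow> bool" where
  "grass_invariant_measure m \<gamma> \<longleftrightarrow>
     sets \<gamma> = sets (grass_borel m) \<and> prob_space \<gamma> \<and>
     (\<forall>g A. orthogonal_transformation g \<longrightarrow> A \<in> sets \<gamma> \<longrightarrow>
        emeasure \<gamma> ((\<lambda>V. g ` V) ` A) = emeasure \<gamma> A)"


section \<open>Hausdorff measure\<close>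

text \<open>The empty set always has weight \<open>0\<close>, which matters only for \<open>m = 0\<close>. Boundedness is
  required explicitly because \<^const>\<open>diameter\<close> is meaningless on unbounded sets.\<close>

definition hausdorff_weight :: "nat \<Rightarrow> 'a::metric_space set \<Rightarrow> ennreal" where
  "hausdorff_weight m C =
     (if C = {} then 0 else ennreal (unit_ball_vol (real m) * (diameter C / 2) ^ m))"

definition hausdorff_pre :: "nat \<Rightarrow> real \<Rightarrow> 'a::metric_space set \<Rightarrow> ennreal" where
  "hausdorff_pre m \<delta> A =
     (INF C \<in> {C :: nat \<Rightarrow> 'a set. A \<subseteq> (\<Union>i. C i) \<and> (\<forall>i. bounded (C i) \<and> diameter (C i) \<le> \<delta>)}.
        \<Sum>i. hausdorff_weight m (C i))"

definition hausdorff_outer :: "nat \<Rightarrow> 'a::metric_space set \<Rightarrow> ennreal" where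
  "hausdorff_outer m A = (SUP \<delta>\<in>{0<..}. hausdorff_pre m \<delta> A)"

text \<open>\<^term>\<open>hausdorff_outer m\<close> is a metric outer measure, hence countably additive on the Borel
  sets, so that \<^const>\<open>measure_of\<close> does not collapse to the zero measure here.\<close>

definition hausdorff_measure :: "nat \<Rightarrow> 'a::metric_space measure" where
  "hausdorff_measure m = measure_of UNIV (sets borel) (hausdorff_outer m)"


section \<open>Lebesgue decomposition\<close>

definition mutually_singular :: "'a measure \<Rightarrow> 'a measure \<Rightarrow> bool" where
  "mutually_singular M N \<longleftrightarrow> (\<exists>A\<in>sets M. emeasure M A = 0 \<and> emeasure N (space N - A) = 0)"

definition lebesgue_decomposition ::
    "'a measure \<Rightarrow> 'a measure \<Rightarrow> 'a measure \<Rightarrow> 'a measure \<Rightarrow> bool" where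
  "lebesgue_decomposition M N Na Ns \<longleftrightarrow>
     sets Na = sets N \<and> sets Ns = sets N \<and>
     (\<forall>A\<in>sets N. emeasure N A = emeasure Na A + emeasure Ns A) \<and>
     absolutely_continuous M Na \<and> mutually_singular M Ns"

text \<open>The absolutely continuous part of \<open>N\<close> with respect to \<open>M\<close>; for finite \<open>N\<close> it exists and
  is unique whatever \<open>M\<close> is, as the lemma \<open>ac_part_decomposition\<close> shows.\<close>

definition ac_part :: "'a measure \<Rightarrow> 'a measure \<Rightarrow> 'a measure" where
  "ac_part M N = (THE Na. \<exists>Ns. lebesgue_decomposition M N Na Ns)"

definition proj_measure :: "'a::euclidean_space set \<Rightarrow> 'a measure \<Rightarrow> 'a measure" where
  "proj_measure V \<mu> = distr \<mu> (restrict_space borel V) (orth_proj V)"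

text \<open>\<open>(\<pi>\<^sub>V\<mu>)\<^sup>a\<close>, as a measure on \<open>V\<close>.\<close>

definition proj_measure_ac :: "nat \<Rightarrow> 'a::euclidean_space set \<Rightarrow> 'a measure \<Rightarrow> 'a measure" where
  "proj_measure_ac m V \<mu> =
     ac_part (restrict_space (hausdorff_measure m) V) (proj_measure V \<mu>)"


section \<open>The definitions are meaningful\<close>

lemma orth_proj_unique:
  assumes "subspace V" "v \<in> V" "\<And>w. w \<in> V \<Longrightarrow> orthogonal (x - v) w"
  shows "orth_proj V x = v"
  unfolding orth_proj_def
proof (rule the_equality)
  fix u assume u: "u \<in> V \<and> (\<forall>w\<in>V. orthogonal (x - u) w)"
  have d: "u - v \<in> V" using u assms subspace_diff by blast
  have "(u - v) \<bullet> (u - v) = (x - v) \<bullet> (u - v) - (x - u) \<bullet> (u - v)"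
    by (simp add: inner_diff_left)
  also have "\<dots> = 0" using assms(3)[OF d] u d by (auto simp: orthogonal_def)
  finally show "u = v" by simp
qed (use assms in auto)

lemma orth_proj_props:
  assumes "subspace V"
  shows "orth_proj V x \<in> V" "w \<in> V \<Longrightarrow> orthogonal (x - orth_proj V x) w"
proof -
  obtain y z where yz: "y \<in> span V" "\<And>w. w \<in> span V \<Longrightarrow> orthogonal z w" "x = y + z"
    using orthogonal_subspace_decomp_exists[of V x] by metis
  have sp: "span V = V" using assms by (simp add: span_eq_iff)
  have "orth_proj V x = y"
    by (rule orth_proj_unique) (use assms yz sp in auto)
  then show "orth_proj V x \<in> V" "w \<in> V \<Longrightarrow> orthogonal (x - orth_proj V x) w"
    using yz sp by auto
qed

lemma orth_proj_fixes: "subspace V \<Longrightarrow> v \<in> V \<Longrightarrow> orth_proj V v = v"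
  by (rule orth_proj_unique) (auto simp: orthogonal_def)

lemma linear_orth_proj:
  assumes V: "subspace V"
  shows "linear (orth_proj V)"
proof (rule linearI)
  note p = orth_proj_props[OF V, unfolded orthogonal_def inner_diff_left]
  show "orth_proj V (x + y) = orth_proj V x + orth_proj V y" for x y
  proof (rule orth_proj_unique[OF V])
    show "orthogonal (x + y - (orth_proj V x + orth_proj V y)) w" if "w \<in> V" for w
      using p(2)[OF that, of x] p(2)[OF that, of y]
      by (simp add: orthogonal_def inner_diff_left inner_add_left)
  qed (simp add: p(1) V subspace_add)
  show "orth_proj V (c *\<^sub>R x) = c *\<^sub>R orth_proj V x" for c x
  proof (rule orth_proj_unique[OF V])
    show "orthogonal (c *\<^sub>R x - c *\<^sub>R orth_proj V x) w" if "w \<in> V" for w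
      using p(2)[OF that, of x] by (simp add: orthogonal_def inner_diff_left)
  qed (simp add: p(1) V subspace_scale)
qed

lemma bounded_linear_orth_proj: "subspace V \<Longrightarrow> bounded_linear (orth_proj V)"
  by (simp add: linear_conv_bounded_linear[symmetric] linear_orth_proj)

lemma grass_dist_onorm:
  assumes "subspace V" "subspace W"
  shows "grass_dist V W = onorm (\<lambda>x. orth_proj V x - orth_proj W x)"
  unfolding grass_dist_def norm_blinfun.rep_eq minus_blinfun.rep_eq
  using assms by (simp add: bounded_linear_Blinfun_apply bounded_linear_orth_proj)

lemma Metric_space_grassmannian: "Metric_space (grassmannian m) grass_dist"
proof
  fix V W :: "'a set" assume "V \<in> grassmannian m" "W \<in> grassmannian m"
  then have V: "subspace V" and W: "subspace W" by (auto simp: grassmannian_def)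
  have "V = W" if "grass_dist V W = 0"
  proof -
    have "Blinfun (orth_proj V) = Blinfun (orth_proj W)"
      using that by (simp add: grass_dist_def)
    then have "orth_proj V = orth_proj W"
      using V W bounded_linear_Blinfun_apply bounded_linear_orth_proj by metis
    then show ?thesis using orth_proj_props(1) orth_proj_fixes V W by (metis subsetI subset_antisym)
  qed
  then show "grass_dist V W = 0 \<longleftrightarrow> V = W" by (auto simp: grass_dist_def)
next
  fix U V W :: "'a set"
  show "grass_dist U W \<le> grass_dist U V + grass_dist V W"
    unfolding grass_dist_def by (metis dist_norm dist_triangle)
qed (simp_all add: grass_dist_def norm_minus_commute)

lemma measurable_orth_proj:
  assumes "subspace V"
  shows "orth_proj V \<in> borel \<rightarrow>\<^sub>M restrict_space borel V"
proof (rule measurable_restrict_space2)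
  show "orth_proj V \<in> borel \<rightarrow>\<^sub>M borel"
    by (intro borel_measurable_continuous_onI linear_continuous_on bounded_linear_orth_proj assms)
qed (use orth_proj_props(1)[OF assms] in auto)

lemma sets_hausdorff_measure [simp]: "sets (hausdorff_measure m) = sets borel"
  and space_hausdorff_measure [simp]: "space (hausdorff_measure m) = UNIV"
  using sets.sigma_sets_eq[of borel] sets.space_closed[of borel]
  by (simp_all add: hausdorff_measure_def)

lemma lebesgue_decomposition_unique:
  assumes M: "sets M = sets N"
    and 1: "lebesgue_decomposition M N Na Ns" and 2: "lebesgue_decomposition M N Na' Ns'"
  shows "Na = Na'"
proof -
  have key: "emeasure P X = emeasure N (X - (A \<union> A'))"
    if P: "lebesgue_decomposition M N P Q" and X: "X \<in> sets N"
      and A: "A \<in> sets M" "emeasure M A = 0" "emeasure Q (space Q - A) = 0"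
      and A': "A' \<in> sets M" "emeasure M A' = 0"
    for P Q X A A'
  proof -
    note P' = P[unfolded lebesgue_decomposition_def absolutely_continuous_def]
    have sp: "space Q = space N" using P' sets_eq_imp_space_eq by blast
    have AA: "A \<union> A' \<in> null_sets M" using A A' by (simp add: null_sets.Un null_setsI)
    then have "A \<union> A' \<in> null_sets P" using P' by blast
    then have e: "emeasure P X = emeasure P (X - (A \<union> A'))"
      using X P' emeasure_Diff_null_set by metis
    have "space Q - A \<in> null_sets Q" using A P' M by (metis null_setsI sets.compl_sets)
    then have "X - (A \<union> A') \<in> null_sets Q"
    proof (rule null_sets_subset)
      show "X - (A \<union> A') \<in> sets Q" using X A(1) A'(1) P' M by simp
      show "X - (A \<union> A') \<subseteq> space Q - A" using sets.sets_into_space[OF X] sp by blast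
    qed
    moreover have "X - (A \<union> A') \<in> sets N" using X A A' M by auto
    ultimately show ?thesis using P' e by (simp add: null_setsD1)
  qed
  obtain A where A: "A \<in> sets M" "emeasure M A = 0" "emeasure Ns (space Ns - A) = 0"
    using 1 unfolding lebesgue_decomposition_def mutually_singular_def by blast
  obtain A' where A': "A' \<in> sets M" "emeasure M A' = 0" "emeasure Ns' (space Ns' - A') = 0"
    using 2 unfolding lebesgue_decomposition_def mutually_singular_def by blast
  show ?thesis
  proof (rule measure_eqI)
    show s: "sets Na = sets Na'" using 1 2 by (simp add: lebesgue_decomposition_def)
    fix X assume "X \<in> sets Na"
    then have X: "X \<in> sets N" using 1 by (simp add: lebesgue_decomposition_def)
    show "emeasure Na X = emeasure Na' X"
      using key[OF 1 X A A'(1,2)] key[OF 2 X A' A(1,2)] by (simp add: Un_commute)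
  qed
qed

lemma lebesgue_decomposition_exists:
  assumes M: "sets M = sets N" and fin: "finite_measure N"
  shows "\<exists>Na Ns. lebesgue_decomposition M N Na Ns"
proof -
  interpret finite_measure N by fact
  have "(SUP A\<in>null_sets M. emeasure N A) \<in> emeasure N ` null_sets M"
  proof -
    obtain f where f: "range f \<subseteq> emeasure N ` null_sets M"
        "(SUP A\<in>null_sets M. emeasure N A) = (SUP i::nat. f i)"
      using ennreal_Sup_countable_SUP[of "emeasure N ` null_sets M"] by blast
    have "\<forall>i. \<exists>A. A \<in> null_sets M \<and> f i = emeasure N A" using f(1) by blast
    then obtain A where A: "\<And>i. A i \<in> null_sets M" "\<And>i. f i = emeasure N (A i)" by metis
    have U: "(\<Union>i. A i) \<in> null_sets M" using A(1) by auto
    have "f i \<le> emeasure N (\<Union>i. A i)" for i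
      unfolding A(2) using U M by (intro emeasure_mono) auto
    then have "(SUP A\<in>null_sets M. emeasure N A) \<le> emeasure N (\<Union>i. A i)"
      unfolding f(2) by (intro SUP_least)
    then have "(SUP A\<in>null_sets M. emeasure N A) = emeasure N (\<Union>i. A i)"
      using U by (intro antisym) (auto intro: SUP_upper)
    then show ?thesis using U by blast
  qed
  then obtain Z where Z: "Z \<in> null_sets M" and
    max: "\<And>A. A \<in> null_sets M \<Longrightarrow> emeasure N A \<le> emeasure N Z"
    by (metis (no_types, lifting) SUP_upper imageE)
  have ZN: "Z \<in> sets N" using Z M by auto
  define Na Ns where "Na = density N (indicator (space N - Z))" and "Ns = density N (indicator Z)"
  have ea: "emeasure Na X = emeasure N (X - Z)" if "X \<in> sets N" for X
  proof -
    have "emeasure Na X = emeasure N ((space N - Z) \<inter> X)"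
      unfolding Na_def using that ZN by (intro emeasure_restricted) auto
    also have "(space N - Z) \<inter> X = X - Z" using sets.sets_into_space[OF that] by auto
    finally show ?thesis .
  qed
  have es: "emeasure Ns X = emeasure N (Z \<inter> X)" if "X \<in> sets N" for X
    unfolding Ns_def using that ZN by (intro emeasure_restricted)
  have "absolutely_continuous M Na"
    unfolding absolutely_continuous_def
  proof
    fix X assume X: "X \<in> null_sets M"
    have XN: "X \<in> sets N" using X M by auto
    have "emeasure N Z + emeasure N (X - Z) = emeasure N (Z \<union> (X - Z))"
      using XN ZN by (intro plus_emeasure) auto
    also have "\<dots> \<le> emeasure N Z" using X Z max[of "Z \<union> X"] by (simp add: null_sets.Un)
    finally have "emeasure N (X - Z) = 0"
      by (metis add.right_neutral emeasure_finite ennreal_add_left_cancel_le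
          infinity_ennreal_def le_zero_eq)
    then show "X \<in> null_sets Na" using XN ea[OF XN] by (auto simp: Na_def)
  qed
  moreover have "mutually_singular M Ns"
    unfolding mutually_singular_def using Z M ZN es[of "space N - Z"]
    by (intro bexI[of _ Z]) (auto simp: Ns_def)
  moreover have "emeasure N X = emeasure Na X + emeasure Ns X" if X: "X \<in> sets N" for X
    using plus_emeasure[of "X - Z" N "Z \<inter> X"] X ZN ea[OF X] es[OF X]
    by (simp add: Int_commute Un_Diff_Int inf_sup_aci Diff_Int_distrib)
  ultimately show ?thesis
    unfolding lebesgue_decomposition_def
    by (intro exI[of _ Na] exI[of _ Ns]) (simp add: Na_def Ns_def)
qed

lemma ac_part_decomposition:
  assumes "sets M = sets N" "finite_measure N"
  shows "\<exists>Ns. lebesgue_decomposition M N (ac_part M N) Ns"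
proof -
  have "\<exists>!Na. \<exists>Ns. lebesgue_decomposition M N Na Ns"
    using lebesgue_decomposition_exists[OF assms] lebesgue_decomposition_unique[OF assms(1)] by blast
  then show ?thesis unfolding ac_part_def by (rule theI')
qed

end

theory Submission
  imports Defs
begin

text \<open>Suppose that \<open>\<pi>\<^sub>V\<mu>\<close> is singular for almost every \<open>V \<in> \<Sigma>\<close>, and let \<open>A\<close>, \<open>B\<close> be two balls at
  positive distance. Since \<open>\<gamma>{V. \<bar>\<pi>\<^sub>V z\<bar> \<le> r} \<le> C (r/\<bar>z\<bar>)\<^sup>m\<close>, Fubini and Fatou show that for almost
  every \<open>V\<close> the quantity \<open>r\<^sup>-\<^sup>m (\<mu>\<times>\<mu>){(x, y) \<in> A \<times> B. \<bar>\<pi>\<^sub>V(x - y)\<bar> \<le> m r}\<close> stays bounded along a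
  sequence \<open>r \<rightarrow> 0\<close>. On the other hand, if the projections of \<open>\<mu>|A\<close> and \<open>\<mu>|B\<close> had a common part
  \<open>\<sigma>\<close>, then \<open>\<sigma>\<close> would be carried by a null set of \<open>V\<close>, hence up to a small error by a set meeting
  only \<open>O(\<epsilon> r\<^sup>-\<^sup>m)\<close> cells of a grid of side \<open>r\<close>, and Cauchy--Schwarz over these cells would bound
  the squared mass of \<open>\<sigma>\<close> by \<open>O(\<epsilon>)\<close> times that quantity. So \<open>\<pi>\<^sub>V(\<mu>|A)\<close> and \<open>\<pi>\<^sub>V(\<mu>|B)\<close> are mutually singular.
  Separating them for countably many pairs of balls yields a set of full measure on which
  \<open>\<pi>\<^sub>V\<close> is injective.\<close>

section \<open>Hausdorff measure\<close>

text \<open>Two demands on the scale \<open>r\<close> compete. Fatou controls only a lower limit, so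
  the bound on close pairs holds along scales that depend on \<open>V\<close> and cannot be
  prescribed. The cell count for a cover holds only when \<open>r\<close> is below every radius,
  while a null set may need infinitely many balls with radii tending to 0. Hence null carriers are
  replaced by finite families of balls that leave a small mass uncovered: such a family has a least
  radius, and some good scale lies below it. The common part is never constructed. For each integer
  \<open>j\<close>, a Hahn set on which the projection from \<open>B\<close> is at most
  \<open>j\<close> times that from \<open>A\<close> takes its place; this domination turns the
  square of a cell's mass into a product of masses from both sides, which is what the product
  measure sees. The exponent \<open>m\<close> comes from volume: inside the unit ball, the points
  within \<open>s\<close> of the orthogonal complement of \<open>V\<close> fill a volume of order
  \<open>s ^ m\<close>. Measurability of the set in alternative (2) has to be proved, because
  \<open>emeasure\<close> is 0 on nonmeasurable sets and its vanishing would otherwise say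
  nothing.\<close>

lemma hausdorff_pre_mono: "A \<subseteq> B \<Longrightarrow> hausdorff_pre m \<delta> A \<le> hausdorff_pre m \<delta> B"
  unfolding hausdorff_pre_def by (intro INF_superset_mono) auto

lemma hausdorff_pre_le:
  assumes "A \<subseteq> (\<Union>i. C i)" "\<And>i. bounded (C i)" "\<And>i. diameter (C i) \<le> \<delta>"
  shows "hausdorff_pre m \<delta> A \<le> (\<Sum>i. hausdorff_weight m (C i))"
  unfolding hausdorff_pre_def using assms by (intro INF_lower) auto

lemma hausdorff_pre_lessE:
  assumes "hausdorff_pre m \<delta> A < e"
  obtains C where "A \<subseteq> (\<Union>i. C i)" "\<And>i. bounded (C i)" "\<And>i. diameter (C i) \<le> \<delta>"
    "(\<Sum>i. hausdorff_weight m (C i)) < e"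
  using assms unfolding hausdorff_pre_def INF_less_iff by auto

lemma hausdorff_pre_le_weight:
  assumes "bounded A" "diameter A \<le> \<delta>" "0 \<le> \<delta>"
  shows "hausdorff_pre m \<delta> A \<le> hausdorff_weight m A"
proof -
  \<comment> \<open>The single set is padded to a sequence by empty sets, whose weight is 0 even for
    \<open>m = 0\<close>.\<close>
  have "hausdorff_pre m \<delta> A \<le> (\<Sum>i::nat. hausdorff_weight m (if i = 0 then A else {}))"
    by (rule hausdorff_pre_le) (use assms in \<open>auto split: if_splits\<close>)
  also have "\<dots> = (\<Sum>i\<in>{0}. hausdorff_weight m (if i = 0 then A else {}))"
    using suminf_finite[of "{0::nat}" "\<lambda>i. hausdorff_weight m (if i = 0 then A else {})"]
    by (simp add: hausdorff_weight_def)
  finally show ?thesis by simp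
qed

lemma hausdorff_pre_empty: "0 \<le> \<delta> \<Longrightarrow> hausdorff_pre m \<delta> {} = 0"
  using hausdorff_pre_le_weight[of "{}" \<delta> m] by (simp add: hausdorff_weight_def)

text \<open>Covers of the \<open>A i\<close> that are optimal up to \<open>e / 2 ^ Suc i\<close> are
  merged into one sequence by \<open>prod_decode\<close>; the errors add up to
  \<open>e\<close>.\<close>

lemma hausdorff_pre_UN_le:
  fixes A :: "nat \<Rightarrow> 'a::metric_space set"
  shows "hausdorff_pre m \<delta> (\<Union>i. A i) \<le> (\<Sum>i. hausdorff_pre m \<delta> (A i))"
proof (rule ennreal_le_epsilon)
  fix e :: real
  assume fin: "(\<Sum>i. hausdorff_pre m \<delta> (A i)) < top" and e: "0 < e"
  have "\<exists>C. A i \<subseteq> (\<Union>j. C j) \<and> (\<forall>j. bounded (C j) \<and> diameter (C j) \<le> \<delta>) \<and>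
      (\<Sum>j. hausdorff_weight m (C j)) < hausdorff_pre m \<delta> (A i) + ennreal (e * (1/2) ^ Suc i)" for i
  proof -
    have "hausdorff_pre m \<delta> (A i) < top"
      using fin by (metis ennreal_suminf_lessD)
    then have "hausdorff_pre m \<delta> (A i) < hausdorff_pre m \<delta> (A i) + ennreal (e * (1/2) ^ Suc i)"
      using e by (simp add: ennreal_less_zero_iff)
    then show ?thesis by (elim hausdorff_pre_lessE) blast
  qed
  then obtain C where C: "\<And>i. A i \<subseteq> (\<Union>j. C i j)" "\<And>i j. bounded (C i j)"
      "\<And>i j. diameter (C i j) \<le> \<delta>"
      "\<And>i. (\<Sum>j. hausdorff_weight m (C i j)) < hausdorff_pre m \<delta> (A i) + ennreal (e * (1/2) ^ Suc i)"
    by metis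
  define D where "D k = case_prod C (prod_decode k)" for k
  have "hausdorff_pre m \<delta> (\<Union>i. A i) \<le> (\<Sum>k. hausdorff_weight m (D k))"
  proof (rule hausdorff_pre_le)
    show "(\<Union>i. A i) \<subseteq> (\<Union>k. D k)"
    proof
      fix x assume "x \<in> (\<Union>i. A i)"
      then obtain i j where "x \<in> C i j" using C(1) by blast
      then have "x \<in> D (prod_encode (i, j))" by (simp add: D_def)
      then show "x \<in> (\<Union>k. D k)" by blast
    qed
  qed (use C in \<open>auto simp: D_def split: prod.split\<close>)
  also have "\<dots> = (\<Sum>i. \<Sum>j. hausdorff_weight m (C i j))"
    using suminf_ennreal_2dimen[of "\<lambda>i. \<Sum>j. hausdorff_weight m (C i j)"
        "\<lambda>(i, j). hausdorff_weight m (C i j)"]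
    by (simp add: D_def case_prod_beta comp_def)
  also have "\<dots> \<le> (\<Sum>i. hausdorff_pre m \<delta> (A i) + ennreal (e * (1/2) ^ Suc i))"
    by (intro suminf_le less_imp_le C(4)) auto
  also have "\<dots> = (\<Sum>i. hausdorff_pre m \<delta> (A i)) + (\<Sum>i. ennreal (e * (1/2) ^ Suc i))"
    by (simp add: suminf_add[symmetric])
  also have "(\<Sum>i. ennreal (e * (1/2) ^ Suc i)) = ennreal e"
  proof -
    have "(\<lambda>i. e * (1/2) ^ Suc i) sums (e * 1)"
      by (intro sums_mult power_half_series)
    then show ?thesis using e by (intro suminf_ennreal_eq) auto
  qed
  finally show "hausdorff_pre m \<delta> (\<Union>i. A i) \<le> (\<Sum>i. hausdorff_pre m \<delta> (A i)) + ennreal e" .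
qed

lemma hausdorff_pre_le_outer: "0 < \<delta> \<Longrightarrow> hausdorff_pre m \<delta> A \<le> hausdorff_outer m A"
  unfolding hausdorff_outer_def by (intro SUP_upper) auto

lemma hausdorff_outer_mono: "A \<subseteq> B \<Longrightarrow> hausdorff_outer m A \<le> hausdorff_outer m B"
  unfolding hausdorff_outer_def by (intro SUP_mono') (auto intro: hausdorff_pre_mono)

lemma hausdorff_outer_empty [simp]: "hausdorff_outer m {} = 0"
  unfolding hausdorff_outer_def by (intro SUP_eq_const) (auto simp: hausdorff_pre_empty)

lemma hausdorff_outer_UN_le:
  fixes A :: "nat \<Rightarrow> 'a::metric_space set"
  shows "hausdorff_outer m (\<Union>i. A i) \<le> (\<Sum>i. hausdorff_outer m (A i))"
  unfolding hausdorff_outer_def[of m "\<Union>i. A i"]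
proof (rule SUP_least)
  fix \<delta> :: real assume "\<delta> \<in> {0<..}"
  then have "(\<Sum>i. hausdorff_pre m \<delta> (A i)) \<le> (\<Sum>i. hausdorff_outer m (A i))"
    by (intro suminf_le hausdorff_pre_le_outer) auto
  then show "hausdorff_pre m \<delta> (\<Union>i. A i) \<le> (\<Sum>i. hausdorff_outer m (A i))"
    using hausdorff_pre_UN_le[of m \<delta> A] by (rule order_trans[rotated])
qed

lemma outer_measure_space_hausdorff: "outer_measure_space UNIV (hausdorff_outer m)"
  by (auto simp: outer_measure_space_def positive_def increasing_def countably_subadditive_def
      intro: hausdorff_outer_mono hausdorff_outer_UN_le)

lemma hausdorff_outer_Un_le: "hausdorff_outer m (A \<union> B) \<le> hausdorff_outer m A + hausdorff_outer m B"
proof -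
  have "hausdorff_outer m (A \<union> B) \<le> (\<Sum>i. hausdorff_outer m (binaryset A B i))"
    using hausdorff_outer_UN_le[of m "binaryset A B"] by (simp add: UN_binaryset_eq)
  also have "\<dots> = hausdorff_outer m A + hausdorff_outer m B"
    by (simp add: suminf_binaryset_eq)
  finally show ?thesis .
qed

text \<open>A covering set of diameter less than \<open>d\<close> cannot meet both \<open>A\<close>
  and \<open>B\<close>, so every fine cover of the union splits into a cover of each.\<close>

lemma hausdorff_outer_separated:
  assumes d: "0 < d" and sep: "\<And>a b. a \<in> A \<Longrightarrow> b \<in> B \<Longrightarrow> d \<le> dist a b"
  shows "hausdorff_outer m A + hausdorff_outer m B \<le> hausdorff_outer m (A \<union> B)"
proof -
  have *: "hausdorff_pre m \<delta> A + hausdorff_pre m \<epsilon> B \<le> hausdorff_outer m (A \<union> B)"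
    if \<delta>: "0 < \<delta>" and \<epsilon>: "0 < \<epsilon>" for \<delta> \<epsilon>
  proof -
    \<comment> \<open>A single scale finer than both given ones, with \<open>d/2\<close> keeping it
      strictly below \<open>d\<close>.\<close>
    define \<eta> where "\<eta> = min (min \<delta> \<epsilon>) (d/2)"
    have \<eta>: "0 < \<eta>" "\<eta> \<le> \<delta>" "\<eta> \<le> \<epsilon>" "\<eta> < d" using d \<delta> \<epsilon> by (auto simp: \<eta>_def)
    have "hausdorff_pre m \<delta> A + hausdorff_pre m \<epsilon> B \<le> hausdorff_pre m \<eta> (A \<union> B)"
      unfolding hausdorff_pre_def[of m \<eta>]
    proof (rule INF_greatest)
      fix C assume "C \<in> {C::nat \<Rightarrow> 'a set. A \<union> B \<subseteq> (\<Union>i. C i) \<and>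
                          (\<forall>i. bounded (C i) \<and> diameter (C i) \<le> \<eta>)}"
      then have C: "A \<union> B \<subseteq> (\<Union>i. C i)" "\<And>i. bounded (C i)" "\<And>i. diameter (C i) \<le> \<eta>" by auto
      define CA CB where "CA i = (if C i \<inter> A = {} then {} else C i)"
        and "CB i = (if C i \<inter> B = {} then {} else C i)" for i
      have "hausdorff_pre m \<delta> A \<le> (\<Sum>i. hausdorff_weight m (CA i))"
      proof (rule hausdorff_pre_le)
        show "A \<subseteq> (\<Union>i. CA i)" using C(1) by (fastforce simp: CA_def)
        show "diameter (CA i) \<le> \<delta>" for i using order_trans[OF C(3) \<eta>(2)] \<delta> by (auto simp: CA_def)
      qed (use C(2) in \<open>auto simp: CA_def\<close>)
      moreover have "hausdorff_pre m \<epsilon> B \<le> (\<Sum>i. hausdorff_weight m (CB i))"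
      proof (rule hausdorff_pre_le)
        show "B \<subseteq> (\<Union>i. CB i)" using C(1) by (fastforce simp: CB_def)
        show "diameter (CB i) \<le> \<epsilon>" for i using order_trans[OF C(3) \<eta>(3)] \<epsilon> by (auto simp: CB_def)
      qed (use C(2) in \<open>auto simp: CB_def\<close>)
      moreover have "hausdorff_weight m (CA i) + hausdorff_weight m (CB i) \<le> hausdorff_weight m (C i)" for i
      proof -
        have "C i \<inter> A = {} \<or> C i \<inter> B = {}"
        proof (rule ccontr)
          assume "\<not> ?thesis"
          then obtain a b where ab: "a \<in> C i" "a \<in> A" "b \<in> C i" "b \<in> B" by blast
          have "dist a b \<le> diameter (C i)" using ab C(2) by (intro diameter_bounded_bound)
          then show False using sep[OF ab(2,4)] C(3)[of i] \<eta> by linarith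
        qed
        then show ?thesis by (auto simp: CA_def CB_def hausdorff_weight_def)
      qed
      then have "(\<Sum>i. hausdorff_weight m (CA i) + hausdorff_weight m (CB i)) \<le> (\<Sum>i. hausdorff_weight m (C i))"
        by (intro suminf_le) auto
      ultimately show "hausdorff_pre m \<delta> A + hausdorff_pre m \<epsilon> B \<le> (\<Sum>i. hausdorff_weight m (C i))"
        by (simp add: suminf_add[symmetric]) (meson add_mono order_trans)
    qed
    also have "\<dots> \<le> hausdorff_outer m (A \<union> B)" using \<eta> by (intro hausdorff_pre_le_outer)
    finally show ?thesis .
  qed
  have "hausdorff_outer m A + hausdorff_outer m B =
      (SUP \<delta>\<in>{0<..}. SUP \<epsilon>\<in>{0<..}. hausdorff_pre m \<delta> A + hausdorff_pre m \<epsilon> B)"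
    unfolding hausdorff_outer_def
    by (simp add: ennreal_SUP_add_left[symmetric] ennreal_SUP_add_right[symmetric])
  also have "\<dots> \<le> hausdorff_outer m (A \<union> B)" using * by (intro SUP_least) auto
  finally show ?thesis .
qed

lemma ennreal_suminf_tail:
  fixes a :: "nat \<Rightarrow> ennreal"
  assumes "suminf a < top" "0 < e"
  obtains k where "(\<Sum>i. a (i + k)) < ennreal e"
proof -
  define b where "b i = enn2real (a i)" for i
  have a: "a i = ennreal (b i)" for i
    using ennreal_suminf_lessD[OF assms(1), of i] by (simp add: b_def less_top)
  have b: "0 \<le> b i" for i by (simp add: b_def)
  have s: "summable b"
    using assms(1) a b by (metis suminf_cong summable_suminf_not_top top.not_eq_extremum)
  obtain k where k: "norm (\<Sum>i. b (i + k)) < e"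
    using suminf_exist_split[OF assms(2) s] by blast
  have "(\<Sum>i. a (i + k)) = ennreal (\<Sum>i. b (i + k))"
    unfolding a by (intro suminf_ennreal2 b) (use s in \<open>simp add: summable_iff_shift\<close>)
  then show thesis using k assms(2) by (intro that[of k]) (simp add: ennreal_lessI)
qed

text \<open>Each piece is separated from the union of its predecessors, with a gap that may shrink
  with \<open>k\<close>; additivity of two separated sets therefore applies at every finite
  stage.\<close>

lemma hausdorff_outer_chain:
  fixes R :: "nat \<Rightarrow> 'a::metric_space set"
  assumes sep: "\<And>k. \<exists>d>0. \<forall>x\<in>(\<Union>j<k. R j). \<forall>y\<in>R k. d \<le> dist x y"
  shows "(\<Sum>j. hausdorff_outer m (R j)) \<le> hausdorff_outer m (\<Union>j. R j)"
proof (rule suminf_le_const)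
  fix k
  have "(\<Sum>j<k. hausdorff_outer m (R j)) \<le> hausdorff_outer m (\<Union>j<k. R j)"
  proof (induction k)
    case (Suc k)
    obtain d where "0 < d" "\<forall>x\<in>(\<Union>j<k. R j). \<forall>y\<in>R k. d \<le> dist x y" using sep by blast
    then have "hausdorff_outer m (\<Union>j<k. R j) + hausdorff_outer m (R k)
        \<le> hausdorff_outer m ((\<Union>j<k. R j) \<union> R k)"
      by (intro hausdorff_outer_separated) auto
    moreover have "(\<Union>j<k. R j) \<union> R k = (\<Union>j<Suc k. R j)" by (auto simp: less_Suc_eq)
    ultimately show ?case using Suc by (auto intro: order_trans add_right_mono)
  qed simp
  also have "\<dots> \<le> hausdorff_outer m (\<Union>j. R j)" by (intro hausdorff_outer_mono) auto
  finally show "(\<Sum>j<k. hausdorff_outer m (R j)) \<le> hausdorff_outer m (\<Union>j. R j)" .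
qed auto

text \<open>Caratheodory's criterion. The shells \<open>R k\<close> around \<open>F\<close> with indices of equal parity are
  separated from each other, which makes the sum of their outer measures finite.\<close>

lemma hausdorff_outer_closed_split:
  fixes F :: "'a::metric_space set"
  assumes F: "closed F" "F \<noteq> {}"
  shows "hausdorff_outer m (X \<inter> F) + hausdorff_outer m (X - F) \<le> hausdorff_outer m X"
proof (cases "hausdorff_outer m X < top")
  case False
  then have "hausdorff_outer m X = top" by (simp add: not_less top_unique)
  then show ?thesis by simp
next
  case fin: True
  let ?H = "hausdorff_outer m" and ?q = "\<lambda>k. inverse (real (Suc k))"
  define S where "S k = {x \<in> X. ?q k \<le> infdist x F}" for k
  define R where "R k = S (Suc k) - S k" for k
  have q: "?q (Suc k) < ?q k" "0 < ?q k" for k by (auto simp: field_simps)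
  have q_mono: "?q l \<le> ?q k" if "k \<le> l" for k l using that by (simp add: field_simps)
  have S_mono: "S k \<subseteq> S l" if "k \<le> l" for k l
    using q_mono[OF that] unfolding S_def by (blast intro: order_trans)
  have S_UN: "X - F \<subseteq> (\<Union>k. S k)"
  proof
    fix x assume x: "x \<in> X - F"
    then have "infdist x F > 0"
      using F in_closed_iff_infdist_zero[of F x] infdist_nonneg[of x F] by force
    then obtain k where "?q k < infdist x F" using reals_Archimedean by blast
    then show "x \<in> (\<Union>k. S k)" using x by (auto simp: S_def intro!: exI[of _ k])
  qed
  have sepS: "?q k - ?q (Suc k) \<le> dist x y" if "x \<in> S k" "infdist y F < ?q (Suc k)" for k x y
    using that infdist_triangle[of x F y] by (auto simp: S_def)
  have half: "(\<Sum>j. ?H (R (2 * j + p))) \<le> ?H X" for p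
  proof -
    have "(\<Sum>j. ?H (R (2 * j + p))) \<le> ?H (\<Union>j. R (2 * j + p))"
    proof (rule hausdorff_outer_chain)
      fix k
      show "\<exists>d>0. \<forall>x\<in>(\<Union>j<k. R (2 * j + p)). \<forall>y\<in>R (2 * k + p). d \<le> dist x y"
      proof (cases k)
        case (Suc l)
        \<comment> \<open>\<open>R ?i\<close> is the skipped shell of the other parity: earlier
          shells lie in \<open>S ?i\<close>, the next one avoids \<open>S (Suc ?i)\<close>, and the
          gap is the width of the shell between.\<close>
        let ?i = "2 * l + p + 1"
        have "x \<in> S ?i" if x: "x \<in> (\<Union>j<k. R (2 * j + p))" for x
        proof -
          obtain j where "j < k" "x \<in> S (Suc (2 * j + p))" using x unfolding R_def by blast
          then show ?thesis using S_mono[of "Suc (2 * j + p)" ?i] Suc by auto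
        qed
        moreover have "infdist y F < ?q (Suc ?i)" if "y \<in> R (2 * k + p)" for y
          using that Suc by (auto simp: R_def S_def not_le)
        ultimately show ?thesis
          using sepS[of _ ?i] q(1)[of ?i] by (intro exI[of _ "?q ?i - ?q (Suc ?i)"]) force
      qed (auto intro: exI[of _ 1])
    qed
    also have "\<dots> \<le> ?H X" by (intro hausdorff_outer_mono) (auto simp: R_def S_def)
    finally show ?thesis .
  qed
  have "(\<Sum>j. ?H (R j)) \<le> ?H X + ?H X"
  proof (rule suminf_le_const)
    fix k
    have "(\<Sum>j<k. ?H (R j)) \<le> (\<Sum>j<2 * k. ?H (R j))"
      by (intro sum_mono2) auto
    also have "(\<Sum>j<2 * k. ?H (R j)) = (\<Sum>j<k. ?H (R (2 * j + 0))) + (\<Sum>j<k. ?H (R (2 * j + 1)))"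
      by (induction k) (auto simp: ac_simps)
    also have "\<dots> \<le> (\<Sum>j. ?H (R (2 * j + 0))) + (\<Sum>j. ?H (R (2 * j + 1)))"
      by (intro add_mono sum_le_suminf) auto
    also have "\<dots> \<le> ?H X + ?H X" by (intro add_mono half)
    finally show "(\<Sum>j<k. ?H (R j)) \<le> ?H X + ?H X" .
  qed auto
  then have sfin: "(\<Sum>j. ?H (R j)) < top"
    using fin by (metis ennreal_add_less_top order_le_less_trans)
  show ?thesis
  proof (rule ennreal_le_epsilon)
    fix e :: real assume "0 < e"
    \<comment> \<open>\<open>S k\<close> stays at distance \<open>?q k\<close> from
      \<open>F\<close>, so additivity is known for it; passing from \<open>S k\<close> to
      \<open>X - F\<close> costs only the tail of the convergent series.\<close>
    then obtain k where k: "(\<Sum>i. ?H (R (i + k))) < ennreal e"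
      using ennreal_suminf_tail[OF sfin] by blast
    have "X - F \<subseteq> S k \<union> (\<Union>i. R (i + k))"
    proof
      fix x assume x: "x \<in> X - F"
      define l where "l = (LEAST l. x \<in> S l)"
      have l: "x \<in> S l" using S_UN x unfolding l_def by (metis (mono_tags) LeastI UN_E subsetD)
      show "x \<in> S k \<union> (\<Union>i. R (i + k))"
      proof (cases "l \<le> k")
        case True
        then show ?thesis using S_mono l by blast
      next
        case False
        then have "l = Suc ((l - 1 - k) + k)" by simp
        moreover have "x \<notin> S (l - 1)"
          using not_less_Least[of "l - 1" "\<lambda>l. x \<in> S l"] False by (auto simp: l_def)
        ultimately have "x \<in> R ((l - 1 - k) + k)" using l unfolding R_def
          by (metis DiffI diff_Suc_1)
        then show ?thesis by blast
      qed
    qed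
    then have "?H (X - F) \<le> ?H (S k) + ?H (\<Union>i. R (i + k))"
      using hausdorff_outer_mono hausdorff_outer_Un_le order_trans by metis
    also have "?H (\<Union>i. R (i + k)) \<le> ennreal e"
      using k hausdorff_outer_UN_le[of m "\<lambda>i. R (i + k)"] by simp
    finally have "?H (X \<inter> F) + ?H (X - F) \<le> (?H (X \<inter> F) + ?H (S k)) + ennreal e"
      by (simp add: add_left_mono add.assoc)
    also have "?H (X \<inter> F) + ?H (S k) \<le> ?H ((X \<inter> F) \<union> S k)"
    proof (rule hausdorff_outer_separated)
      show "?q k \<le> dist a b" if "a \<in> X \<inter> F" "b \<in> S k" for a b
        using that infdist_le[of a F b] by (auto simp: S_def dist_commute)
    qed simp
    also have "\<dots> \<le> ?H X" by (intro hausdorff_outer_mono) (auto simp: S_def)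
    finally show "?H (X \<inter> F) + ?H (X - F) \<le> ?H X + ennreal e" by (simp add: add_right_mono)
  qed
qed

text \<open>\<open>measure_of\<close> takes the values of \<open>hausdorff_outer m\<close> only once
  these are known to form a measure on the Borel sets. Closed sets satisfy Caratheodory's criterion,
  so the generated sigma-algebra lies in the \<open>lambda_system\<close>.\<close>

lemma emeasure_hausdorff_measure:
  fixes A :: "'a::metric_space set"
  assumes "A \<in> sets borel"
  shows "emeasure (hausdorff_measure m) A = hausdorff_outer m A"
proof -
  let ?L = "lambda_system UNIV UNIV (hausdorff_outer m :: 'a set \<Rightarrow> ennreal)"
  have L: "measure_space UNIV ?L (hausdorff_outer m)"
    using sigma_algebra.caratheodory_lemma[OF sigma_algebra_Pow, of UNIV "hausdorff_outer m :: 'a set \<Rightarrow> ennreal"]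
    by (simp add: outer_measure_space_hausdorff)
  have "F \<in> ?L" if "closed F" for F :: "'a set"
  proof -
    have "hausdorff_outer m (F \<inter> X) + hausdorff_outer m ((UNIV - F) \<inter> X) = hausdorff_outer m X" for X
    proof (rule antisym)
      show "hausdorff_outer m (F \<inter> X) + hausdorff_outer m ((UNIV - F) \<inter> X) \<le> hausdorff_outer m X"
      proof (cases "F = {}")
        case False
        then show ?thesis using hausdorff_outer_closed_split[OF that False, of m X]
          by (simp add: Int_commute Diff_eq)
      qed simp
      have "X = (F \<inter> X) \<union> ((UNIV - F) \<inter> X)" by auto
      then show "hausdorff_outer m X \<le> hausdorff_outer m (F \<inter> X) + hausdorff_outer m ((UNIV - F) \<inter> X)"
        by (metis hausdorff_outer_Un_le)
    qed
    then show ?thesis by (simp add: lambda_system_def)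
  qed
  then have "sigma_sets UNIV (Collect closed) \<subseteq> ?L"
    using L by (intro sigma_algebra.sigma_sets_subset) (auto simp: measure_space_def)
  then have sub: "sets borel \<subseteq> ?L" by (simp add: borel_eq_closed)
  have "measure_space UNIV (sets borel) (hausdorff_outer m :: 'a set \<Rightarrow> ennreal)"
    by (rule measure_down[OF L _ sub]) (metis sets.sigma_algebra_axioms space_borel)
  then show ?thesis
    using assms unfolding hausdorff_measure_def
    by (intro emeasure_measure_of_sigma) (auto simp: measure_space_def)
qed

section \<open>Singular projections\<close>

lemma hausdorff_pre_Un_le:
  assumes "0 \<le> \<delta>"
  shows "hausdorff_pre m \<delta> (A \<union> B) \<le> hausdorff_pre m \<delta> A + hausdorff_pre m \<delta> B"
proof -
  have "hausdorff_pre m \<delta> (A \<union> B) \<le> (\<Sum>i. hausdorff_pre m \<delta> (binaryset A B i))"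
    using hausdorff_pre_UN_le[of m \<delta> "binaryset A B"] by (simp add: UN_binaryset_eq)
  also have "\<dots> = hausdorff_pre m \<delta> A + hausdorff_pre m \<delta> B"
    by (simp add: suminf_binaryset_eq hausdorff_pre_empty assms)
  finally show ?thesis .
qed

section \<open>Covers by finitely many balls with rational data\<close>

definition ball_union :: "('a::metric_space \<times> real) set \<Rightarrow> 'a set" where
  "ball_union F = (\<Union>(c, r)\<in>F. ball c r)"

text \<open>Rational data keep the number of families countable, so that singularity of \<open>\<pi>\<^sub>V\<mu>\<close>, expressed
  through them, is a measurable condition on \<open>V\<close>.\<close>

definition small_families :: "'a set \<Rightarrow> nat \<Rightarrow> real \<Rightarrow> ('a \<times> real) set set" where
  "small_families D m e = {F. finite F \<and> F \<subseteq> D \<times> (\<rat> \<inter> {0<..}) \<and> (\<Sum>(c, r)\<in>F. r ^ m) < e}"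

lemma open_ball_union [simp]: "open (ball_union F)"
  unfolding ball_union_def by auto

lemma ball_union_mono: "F \<subseteq> G \<Longrightarrow> ball_union F \<subseteq> ball_union G"
  unfolding ball_union_def by blast

lemma ball_union_range: "ball_union (range B) = (\<Union>N. ball_union (B ` {..<N::nat}))"
proof -
  have "range B = (\<Union>N. B ` {..<N})" by (metis UN_lessThan_UNIV image_UN)
  then show ?thesis by (simp add: ball_union_def)
qed

lemma countable_small_families: "countable D \<Longrightarrow> countable (small_families D m e)"
proof -
  assume "countable D"
  then have "countable (D \<times> (\<rat> \<inter> {0<..}))"
    by (intro countable_SIGMA) (auto simp: countable_rat)
  then have "countable {F. finite F \<and> F \<subseteq> D \<times> (\<rat> \<inter> {0<..})}"
    by (rule countable_Collect_finite_subset)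
  then show ?thesis
    by (rule countable_subset[rotated]) (auto simp: small_families_def)
qed

lemma hausdorff_pre_ball_union_le:
  fixes F :: "('a::real_normed_vector \<times> real) set"
  assumes "finite F" "0 < \<delta>" "\<And>c r. (c, r) \<in> F \<Longrightarrow> 0 < r \<and> 2 * r \<le> \<delta>"
  shows "hausdorff_pre m \<delta> (ball_union F)
    \<le> ennreal (unit_ball_vol (real m) * (\<Sum>(c, r)\<in>F. r ^ m))"
  using assms
proof (induction F rule: finite_induct)
  case empty
  then show ?case by (simp add: ball_union_def hausdorff_pre_empty)
next
  case (insert p F)
  obtain c r where p: "p = (c, r)" by force
  have r: "0 < r" "2 * r \<le> \<delta>" using insert.prems p by auto
  have d: "diameter (ball c r) \<le> 2 * r"
  proof (rule diameter_le)
    show "norm (x - y) \<le> 2 * r" if "x \<in> ball c r" "y \<in> ball c r" for x y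
      using that dist_triangle[of x y c] by (simp add: dist_norm[symmetric] dist_commute)
  qed (use r in auto)
  have "ball_union (insert p F) = ball c r \<union> ball_union F" by (simp add: ball_union_def p)
  then have "hausdorff_pre m \<delta> (ball_union (insert p F))
      \<le> hausdorff_pre m \<delta> (ball c r) + hausdorff_pre m \<delta> (ball_union F)"
    using hausdorff_pre_Un_le insert.prems by (metis less_imp_le)
  also have "hausdorff_pre m \<delta> (ball c r) \<le> hausdorff_weight m (ball c r)"
    using d r by (intro hausdorff_pre_le_weight) auto
  also have "hausdorff_weight m (ball c r) \<le> ennreal (unit_ball_vol (real m) * r ^ m)"
    using d r unfolding hausdorff_weight_def
    by (auto intro!: ennreal_leI mult_left_mono power_mono divide_nonneg_nonneg diameter_ge_0)
  also have "hausdorff_pre m \<delta> (ball_union F)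
      \<le> ennreal (unit_ball_vol (real m) * (\<Sum>(c, r)\<in>F. r ^ m))"
    using insert by auto
  also have "ennreal (unit_ball_vol (real m) * r ^ m)
        + ennreal (unit_ball_vol (real m) * (\<Sum>(c, r)\<in>F. r ^ m))
      = ennreal (unit_ball_vol (real m) * (\<Sum>(c, r)\<in>insert p F. r ^ m))"
  proof -
    have "0 \<le> (\<Sum>(c, r)\<in>F. r ^ m)" using insert.prems by (intro sum_nonneg) force
    then show ?thesis
      using insert.hyps r by (subst ennreal_plus[symmetric]) (auto simp: p distrib_left)
  qed
  finally show ?case by (simp add: add_mono)
qed

text \<open>A set of diameter \<open>t\<close> lies in the ball of radius \<open>t\<close> or
  slightly more about each of its points. Continuity of the weight in \<open>t\<close> leaves room
  for a rational radius \<open>r > t\<close>, and the excess \<open>r - t\<close> allows the centre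
  to move into \<open>D\<close>. Since \<open>0 < m\<close>, the empty set fits the formula with
  \<open>t = 0\<close>.\<close>

lemma weight_ball_enlarge:
  fixes C :: "'a::metric_space set"
  assumes m: "0 < m" and C: "bounded C" and e: "0 < e"
    and dense: "\<And>X. open X \<Longrightarrow> X \<noteq> {} \<Longrightarrow> \<exists>d\<in>D. d \<in> X"
  shows "\<exists>c r. c \<in> D \<and> r \<in> \<rat> \<and> 0 < r \<and> C \<subseteq> ball c r \<and>
      ennreal (unit_ball_vol (real m) * (r / 2) ^ m) \<le> hausdorff_weight m C + ennreal e"
proof -
  define t where "t = (if C = {} then 0 else diameter C)"
  have t: "0 \<le> t" using C by (simp add: t_def diameter_ge_0)
  have w: "hausdorff_weight m C = ennreal (unit_ball_vol (real m) * (t / 2) ^ m)"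
    using m by (simp add: t_def hausdorff_weight_def)
  have "isCont (\<lambda>r. unit_ball_vol (real m) * (r / 2) ^ m) t" by (intro continuous_intros) auto
  then obtain d where d: "0 < d" "\<And>r. dist r t < d \<Longrightarrow>
      dist (unit_ball_vol (real m) * (r / 2) ^ m) (unit_ball_vol (real m) * (t / 2) ^ m) < e"
    unfolding continuous_at_eps_delta using e by blast
  obtain r where r: "r \<in> \<rat>" "t < r" "r < t + d"
    using Rats_dense_in_real[of t "t + d"] d(1) by auto
  have "unit_ball_vol (real m) * (r / 2) ^ m \<le> unit_ball_vol (real m) * (t / 2) ^ m + e"
    using d(2)[of r] r by (auto simp: dist_real_def)
  then have "ennreal (unit_ball_vol (real m) * (r / 2) ^ m)
      \<le> ennreal (unit_ball_vol (real m) * (t / 2) ^ m + e)" by (rule ennreal_leI)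
  also have "\<dots> = hausdorff_weight m C + ennreal e" using t e by (simp add: w ennreal_plus)
  finally have wr: "ennreal (unit_ball_vol (real m) * (r / 2) ^ m)
      \<le> hausdorff_weight m C + ennreal e" .
  show ?thesis
  proof (cases "C = {}")
    case True
    obtain c where "c \<in> D" using dense[of UNIV] by auto
    then show ?thesis using r t wr True by (intro exI[of _ c] exI[of _ r]) auto
  next
    case False
    then obtain p where p: "p \<in> C" by auto
    obtain c where c: "c \<in> D" "c \<in> ball p (r - t)"
      using dense[of "ball p (r - t)"] r by (metis ball_eq_empty diff_gt_0_iff_gt not_less open_ball)
    have "C \<subseteq> ball c r"
    proof
      fix x assume "x \<in> C"
      then have "dist p x \<le> t" using diameter_bounded_bound[OF C p] False by (simp add: t_def)
      then show "x \<in> ball c r" using c(2) dist_triangle[of c x p] by (simp add: dist_commute)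
    qed
    then show ?thesis using r t wr c by (intro exI[of _ c] exI[of _ r]) auto
  qed
qed

lemma hausdorff_null_cover:
  fixes A :: "'a::metric_space set"
  assumes m: "0 < m" and A: "hausdorff_outer m A = 0" and e: "0 < e"
    and dense: "\<And>X. open X \<Longrightarrow> X \<noteq> {} \<Longrightarrow> \<exists>d\<in>D. d \<in> X"
  shows "\<exists>B :: nat \<Rightarrow> 'a \<times> real. A \<subseteq> ball_union (range B) \<and>
    (\<forall>N. B ` {..<N} \<in> small_families D m e)"
proof -
  define \<omega> where "\<omega> = unit_ball_vol (real m)"
  have \<omega>: "0 < \<omega>" by (simp add: \<omega>_def)
  \<comment> \<open>Diameters have become radii, which loses the factor \<open>2 ^ m\<close>; the
    remaining half is shared between the weights of the cover and the enlargement errors.\<close>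
  define \<eta> where "\<eta> = e * \<omega> / 2 ^ m / 2"
  have \<eta>: "0 < \<eta>" using e \<omega> by (simp add: \<eta>_def)
  have "hausdorff_pre m 1 A < ennreal \<eta>"
    using hausdorff_pre_le_outer[of 1 m A] A \<eta> by (simp add: ennreal_less_zero_iff)
  then obtain C where C: "A \<subseteq> (\<Union>i. C i)" "\<And>i. bounded (C i)" "\<And>i. diameter (C i) \<le> 1"
      "(\<Sum>i. hausdorff_weight m (C i)) < ennreal \<eta>"
    by (elim hausdorff_pre_lessE) blast
  have "\<exists>c r. c \<in> D \<and> r \<in> \<rat> \<and> 0 < r \<and> C i \<subseteq> ball c r \<and>
      ennreal (\<omega> * (r / 2) ^ m) \<le> hausdorff_weight m (C i) + ennreal (\<eta> * (1/2) ^ Suc i)" for i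
    unfolding \<omega>_def using \<eta> C(2) by (intro weight_ball_enlarge[OF m _ _ dense]) auto
  then obtain c r where cr: "\<And>i. c i \<in> D" "\<And>i. r i \<in> \<rat>" "\<And>i. 0 < r i" "\<And>i. C i \<subseteq> ball (c i) (r i)"
      "\<And>i. ennreal (\<omega> * (r i / 2) ^ m) \<le> hausdorff_weight m (C i) + ennreal (\<eta> * (1/2) ^ Suc i)"
    by metis
  have "(\<Sum>i. ennreal (\<omega> * (r i / 2) ^ m))
      \<le> (\<Sum>i. hausdorff_weight m (C i) + ennreal (\<eta> * (1/2) ^ Suc i))"
    by (intro suminf_le cr) auto
  also have "\<dots> = (\<Sum>i. hausdorff_weight m (C i)) + (\<Sum>i. ennreal (\<eta> * (1/2) ^ Suc i))"
    by (simp add: suminf_add[symmetric])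
  also have "(\<Sum>i. ennreal (\<eta> * (1/2) ^ Suc i)) = ennreal \<eta>"
  proof -
    have "(\<lambda>i. \<eta> * (1/2) ^ Suc i) sums (\<eta> * 1)"
      by (intro sums_mult power_half_series)
    then show ?thesis using \<eta> by (intro suminf_ennreal_eq) auto
  qed
  also have "(\<Sum>i. hausdorff_weight m (C i)) + ennreal \<eta> < ennreal \<eta> + ennreal \<eta>"
    using C(4) by (simp add: ennreal_add_less_top add_strict_right_mono)
  also have "\<dots> = ennreal (2 * \<eta>)" using \<eta> by (simp flip: ennreal_plus)
  finally have sum: "(\<Sum>i. ennreal (\<omega> * (r i / 2) ^ m)) < ennreal (2 * \<eta>)" .
  define B where "B i = (c i, r i)" for i
  have "B ` {..<N} \<in> small_families D m e" for N
  proof -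
    have "ennreal (\<Sum>i<N. \<omega> * (r i / 2) ^ m) = (\<Sum>i<N. ennreal (\<omega> * (r i / 2) ^ m))"
      using cr(3) \<omega> by (intro sum_ennreal[symmetric]) (simp add: less_imp_le)
    also have "\<dots> \<le> (\<Sum>i. ennreal (\<omega> * (r i / 2) ^ m))" by (intro sum_le_suminf) auto
    also note sum
    finally have "(\<Sum>i<N. \<omega> * (r i / 2) ^ m) < 2 * \<eta>"
      using cr(3) \<omega> by (subst (asm) ennreal_less_iff) (auto intro!: sum_nonneg simp: less_imp_le)
    also have "(\<Sum>i<N. \<omega> * (r i / 2) ^ m) = \<omega> / 2 ^ m * (\<Sum>i<N. r i ^ m)"
      by (simp add: sum_distrib_left power_divide)
    also have "2 * \<eta> = \<omega> / 2 ^ m * e" by (simp add: \<eta>_def)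
    finally have "(\<Sum>i<N. r i ^ m) < e"
      using \<omega> mult_less_cancel_left_pos[of "\<omega> / 2 ^ m"] by simp
    \<comment> \<open>Only an inequality, since equal balls of the sequence coincide in the image
      set.\<close>
    moreover have "(\<Sum>(c, r)\<in>B ` {..<N}. r ^ m) \<le> (\<Sum>i<N. (case B i of (c, r) \<Rightarrow> r ^ m))"
      using cr(3) by (intro sum_image_le[where g = "\<lambda>(c, r). r ^ m", unfolded comp_def])
        (auto simp: B_def less_imp_le)
    ultimately show ?thesis using cr by (auto simp: small_families_def B_def)
  qed
  moreover have "A \<subseteq> ball_union (range B)" using C(1) cr(4) by (fastforce simp: ball_union_def B_def)
  ultimately show ?thesis by blast
qed

text \<open>A Borel--Cantelli argument at each scale: the families from index \<open>j\<close> on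
  have total weight at most \<open>2 * \<omega> / 2 ^ j\<close>, and their radii become smaller than
  any given scale.\<close>

lemma hausdorff_outer_limsup_eq_0:
  fixes F :: "nat \<Rightarrow> ('a::real_normed_vector \<times> real) set"
  assumes m: "0 < m" and F: "\<And>k. F k \<in> small_families D m ((1/2) ^ k)"
  shows "hausdorff_outer m (\<Inter>j. \<Union>k. ball_union (F (k + j))) = 0" (is "hausdorff_outer m ?Z = 0")
proof -
  define \<omega> where "\<omega> = unit_ball_vol (real m)"
  have \<omega>: "0 < \<omega>" by (simp add: \<omega>_def)
  have "hausdorff_pre m \<delta> ?Z \<le> 0" if \<delta>: "0 < \<delta>" for \<delta>
  proof (rule ennreal_le_epsilon)
    fix e :: real assume e: "0 < e"
    have "(\<lambda>j. (1/2::real) ^ j) \<longlonglongrightarrow> 0" by (intro LIMSEQ_power_zero) auto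
    \<comment> \<open>The first bound forces every radius below \<open>\<delta>/2\<close>, because
      \<open>r ^ m\<close> is at most the sum over its family; the second makes the tail of the
      series at most \<open>e\<close>.\<close>
    then have "\<forall>\<^sub>F j in sequentially. (1/2::real) ^ j < min ((\<delta>/2) ^ m) (e / (2 * \<omega>))"
      using \<delta> e \<omega> by (intro order_tendstoD) auto
    then obtain j where j: "\<And>k. j \<le> k \<Longrightarrow> (1/2::real) ^ k < (\<delta>/2) ^ m" "(1/2::real) ^ j < e / (2 * \<omega>)"
      by (auto simp: eventually_sequentially)
    have "hausdorff_pre m \<delta> ?Z \<le> hausdorff_pre m \<delta> (\<Union>k. ball_union (F (k + j)))"
      by (intro hausdorff_pre_mono) auto
    also have "\<dots> \<le> (\<Sum>k. hausdorff_pre m \<delta> (ball_union (F (k + j))))"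
      by (rule hausdorff_pre_UN_le)
    also have "\<dots> \<le> (\<Sum>k. ennreal (\<omega> * (1/2) ^ j * (1/2) ^ k))"
    proof (intro suminf_le)
      fix k
      note Fk = F[of "k + j", unfolded small_families_def]
      have pos: "0 < r" if "(c, r) \<in> F (k + j)" for c r using that Fk by auto
      have "hausdorff_pre m \<delta> (ball_union (F (k + j)))
          \<le> ennreal (\<omega> * (\<Sum>(c, r)\<in>F (k + j). r ^ m))"
        unfolding \<omega>_def
      proof (rule hausdorff_pre_ball_union_le)
        fix c r assume cr: "(c, r) \<in> F (k + j)"
        have "r ^ m = (case (c, r) of (c, r) \<Rightarrow> r ^ m)" by simp
        also have "\<dots> \<le> (\<Sum>(c, r)\<in>F (k + j). r ^ m)"
          using Fk pos by (intro member_le_sum[OF cr]) (auto simp: less_imp_le)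
        also have "\<dots> < (\<delta>/2) ^ m" using Fk j(1)[of "k + j"] by auto
        finally have "r < \<delta> / 2" using \<delta> by (intro power_less_imp_less_base[of r m "\<delta>/2"]) auto
        then show "0 < r \<and> 2 * r \<le> \<delta>" using pos[OF cr] by auto
      qed (use Fk \<delta> in auto)
      also have "\<dots> \<le> ennreal (\<omega> * (1/2) ^ j * (1/2) ^ k)"
        using Fk \<omega> by (intro ennreal_leI) (auto simp: power_add ac_simps mult_le_cancel_left_pos)
      finally show "hausdorff_pre m \<delta> (ball_union (F (k + j))) \<le> \<dots>" .
    qed auto
    also have "\<dots> = ennreal (\<omega> * (1/2) ^ j * 2)"
    proof -
      have "(\<lambda>k. \<omega> * (1/2) ^ j * (1/2) ^ k) sums (\<omega> * (1/2) ^ j * (1 / (1 - 1/2)))"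
        by (intro sums_mult geometric_sums) auto
      then show ?thesis using \<omega> by (intro suminf_ennreal_eq) auto
    qed
    also have "\<dots> \<le> 0 + ennreal e" using j(2) \<omega> by (auto intro!: ennreal_leI simp: field_simps)
    finally show "hausdorff_pre m \<delta> ?Z \<le> 0 + ennreal e" .
  qed
  then show ?thesis by (simp add: hausdorff_outer_def SUP_eq_const)
qed

section \<open>Singularity as a countable condition on the subspace\<close>

lemma sets_restrict_hausdorff: "sets (restrict_space (hausdorff_measure m) V) = sets (restrict_space borel V)"
  by (simp add: sets_restrict_space)

text \<open>By uniqueness of the Lebesgue decomposition, the absolutely continuous part vanishes
  exactly when the zero measure and the projected measure itself form a decomposition.\<close>

lemma proj_measure_ac_eq_null_iff_singular:
  fixes V :: "'a::euclidean_space set"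
  assumes V: "subspace V" and \<mu>: "finite_measure \<mu>" "sets \<mu> = sets borel"
  shows "proj_measure_ac m V \<mu> = null_measure (restrict_space borel V)
    \<longleftrightarrow> mutually_singular (restrict_space (hausdorff_measure m) V) (proj_measure V \<mu>)"
proof -
  let ?M = "restrict_space (hausdorff_measure m) V" and ?N = "proj_measure V \<mu>"
  let ?O = "null_measure (restrict_space borel V)"
  have [measurable]: "orth_proj V \<in> \<mu> \<rightarrow>\<^sub>M restrict_space borel V"
    using measurable_orth_proj[OF V] \<mu>(2) by (simp cong: measurable_cong_sets)
  have sN: "sets ?N = sets (restrict_space borel V)" by (simp add: proj_measure_def)
  have sM: "sets ?M = sets ?N" by (simp add: sN sets_restrict_hausdorff)
  have fN: "finite_measure ?N"
    unfolding proj_measure_def by (intro finite_measure.finite_measure_distr \<mu>) measurable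
  show ?thesis
  proof
    assume *: "proj_measure_ac m V \<mu> = ?O"
    obtain Ns where Ns: "lebesgue_decomposition ?M ?N ?O Ns"
      using ac_part_decomposition[OF sM fN] * by (auto simp: proj_measure_ac_def)
    have "Ns = ?N"
      using Ns by (intro measure_eqI) (auto simp: lebesgue_decomposition_def)
    then show "mutually_singular ?M ?N" using Ns by (simp add: lebesgue_decomposition_def)
  next
    assume "mutually_singular ?M ?N"
    then have "lebesgue_decomposition ?M ?N ?O ?N"
      using sM by (auto simp: lebesgue_decomposition_def sN absolutely_continuous_def null_sets_def)
    then show "proj_measure_ac m V \<mu> = ?O"
      using ac_part_decomposition[OF sM fN] lebesgue_decomposition_unique[OF sM]
      unfolding proj_measure_ac_def by blast
  qed
qed

text \<open>This replaces measures on the varying space \<open>V\<close> by Borel subsets of the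
  fixed ambient space. A carrier may be intersected with \<open>V\<close> at no cost, since all
  projections lie in \<open>V\<close>.\<close>

lemma singular_iff_carrier:
  fixes V :: "'a::euclidean_space set"
  assumes V: "subspace V" and \<mu>: "sets \<mu> = sets borel"
  shows "mutually_singular (restrict_space (hausdorff_measure m) V) (proj_measure V \<mu>)
    \<longleftrightarrow> (\<exists>A\<in>sets borel. hausdorff_outer m A = 0 \<and> {x. orth_proj V x \<notin> A} \<in> null_sets \<mu>)"
proof -
  let ?M = "restrict_space (hausdorff_measure m) V"
  have VB: "V \<in> sets borel" using closed_subspace[OF V] by auto
  have [measurable]: "orth_proj V \<in> \<mu> \<rightarrow>\<^sub>M restrict_space borel V"
    using measurable_orth_proj[OF V] \<mu> by (simp cong: measurable_cong_sets)
  have sp: "space \<mu> = UNIV" using sets_eq_imp_space_eq[OF \<mu>] by simp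
  have sM: "A \<in> sets ?M \<longleftrightarrow> A \<in> sets borel \<and> A \<subseteq> V" for A
    using VB by (auto simp: sets_restrict_hausdorff sets_restrict_space_iff)
  have eM: "emeasure ?M A = hausdorff_outer m A" if "A \<in> sets borel" "A \<subseteq> V" for A
    using that VB by (simp add: emeasure_restrict_space emeasure_hausdorff_measure)
  have eN: "emeasure (proj_measure V \<mu>) (space (proj_measure V \<mu>) - A) = emeasure \<mu> {x. orth_proj V x \<notin> A}"
    and mN: "{x. orth_proj V x \<notin> A} \<in> sets \<mu>"
    if "A \<in> sets borel" "A \<subseteq> V" for A
  proof -
    have A: "V - A \<in> sets (restrict_space borel V)" using that VB by (auto simp: sets_restrict_space_iff)
    have eq: "{x. orth_proj V x \<notin> A} = orth_proj V -` (V - A) \<inter> space \<mu>"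
      using orth_proj_props(1)[OF V] by (auto simp: sp)
    show "{x. orth_proj V x \<notin> A} \<in> sets \<mu>" unfolding eq using A by measurable
    have "space (proj_measure V \<mu>) = V" by (simp add: proj_measure_def space_restrict_space)
    then show "emeasure (proj_measure V \<mu>) (space (proj_measure V \<mu>) - A) = emeasure \<mu> {x. orth_proj V x \<notin> A}"
      unfolding eq using A by (simp add: proj_measure_def emeasure_distr)
  qed
  show ?thesis
  proof
    assume "mutually_singular ?M (proj_measure V \<mu>)"
    then show "\<exists>A\<in>sets borel. hausdorff_outer m A = 0 \<and> {x. orth_proj V x \<notin> A} \<in> null_sets \<mu>"
      unfolding mutually_singular_def using eM eN mN sM by (metis null_setsI)
  next
    assume "\<exists>A\<in>sets borel. hausdorff_outer m A = 0 \<and> {x. orth_proj V x \<notin> A} \<in> null_sets \<mu>"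
    then obtain A where A: "A \<in> sets borel" "hausdorff_outer m A = 0"
      "{x. orth_proj V x \<notin> A} \<in> null_sets \<mu>" by blast
    define A' where "A' = A \<inter> V"
    have A': "A' \<in> sets borel" "A' \<subseteq> V" using A VB by (auto simp: A'_def)
    have "hausdorff_outer m A' = 0"
      using hausdorff_outer_mono[of A' A m] A by (simp add: A'_def)
    moreover have "{x. orth_proj V x \<notin> A'} = {x. orth_proj V x \<notin> A}"
      using orth_proj_props(1)[OF V] by (auto simp: A'_def)
    ultimately show "mutually_singular ?M (proj_measure V \<mu>)"
      unfolding mutually_singular_def using A' A eM eN sM by (intro bexI[of _ A']) auto
  qed
qed

text \<open>The right-hand side mentions \<open>V\<close> only through masses of explicit sets, over
  countably many families when \<open>D\<close> is countable. Forwards, a countable cover of the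
  null carrier is truncated by continuity from above. Backwards, the points lying in infinitely many
  of the families form a null carrier.\<close>

lemma proj_measure_ac_eq_null_iff:
  fixes V :: "'a::euclidean_space set"
  assumes m: "0 < m" and V: "subspace V" and \<mu>: "finite_measure \<mu>" "sets \<mu> = sets borel"
    and dense: "\<And>X::'a set. open X \<Longrightarrow> X \<noteq> {} \<Longrightarrow> \<exists>d\<in>D. d \<in> X"
  shows "proj_measure_ac m V \<mu> = null_measure (restrict_space borel V)
    \<longleftrightarrow> (\<forall>k. \<exists>F\<in>small_families D m ((1/2) ^ k).
          measure \<mu> {x. orth_proj V x \<notin> ball_union F} < (1/2) ^ k)"
proof -
  interpret finite_measure \<mu> by fact
  have \<pi>[measurable]: "orth_proj V \<in> \<mu> \<rightarrow>\<^sub>M borel"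
    using measurable_restrict_space2_iff measurable_orth_proj[OF V] \<mu>(2)
    by (metis measurable_cong_sets measurable_restrict_space2_iff)
  have sp: "space \<mu> = UNIV" using sets_eq_imp_space_eq[OF \<mu>(2)] by simp
  have M: "{x. orth_proj V x \<notin> U} \<in> sets \<mu>" if "U \<in> sets borel" for U
  proof -
    have "{x \<in> space \<mu>. orth_proj V x \<notin> U} \<in> sets \<mu>" using that by measurable
    then show ?thesis by (simp add: sp)
  qed
  show ?thesis
    unfolding proj_measure_ac_eq_null_iff_singular[OF V \<mu>] singular_iff_carrier[OF V \<mu>(2)]
  proof (intro iffI allI)
    fix k :: nat
    assume "\<exists>A\<in>sets borel. hausdorff_outer m A = 0 \<and> {x. orth_proj V x \<notin> A} \<in> null_sets \<mu>"
    then obtain A where A: "A \<in> sets borel" "hausdorff_outer m A = 0"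
      "{x. orth_proj V x \<notin> A} \<in> null_sets \<mu>" by blast
    have "\<exists>B :: nat \<Rightarrow> 'a \<times> real. A \<subseteq> ball_union (range B) \<and> (\<forall>N. B ` {..<N} \<in> small_families D m ((1/2) ^ k))"
      by (rule hausdorff_null_cover[OF m A(2)]) (use dense in auto)
    then obtain B :: "nat \<Rightarrow> 'a \<times> real" where B: "A \<subseteq> ball_union (range B)"
      "\<And>N. B ` {..<N} \<in> small_families D m ((1/2) ^ k)" by blast
    let ?E = "\<lambda>N. {x. orth_proj V x \<notin> ball_union (B ` {..<N})}"
    have "(\<lambda>N. measure \<mu> (?E N)) \<longlonglongrightarrow> measure \<mu> (\<Inter>N. ?E N)"
    proof (rule finite_Lim_measure_decseq)
      show "range ?E \<subseteq> sets \<mu>" by (auto intro!: M)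
      have "ball_union (B ` {..<N}) \<subseteq> ball_union (B ` {..<M})" if "N \<le> M" for N M
        using that by (intro ball_union_mono image_mono) auto
      then show "decseq ?E" unfolding decseq_def by blast
    qed
    also have "(\<Inter>N. ?E N) = {x. orth_proj V x \<notin> ball_union (range B)}"
      unfolding ball_union_range by blast
    also have "measure \<mu> \<dots> = 0"
    proof -
      have "{x. orth_proj V x \<notin> ball_union (range B)} \<in> null_sets \<mu>"
        by (rule null_sets_subset[OF A(3)]) (use B(1) in \<open>auto intro!: M\<close>)
      then show ?thesis by (simp add: measure_eq_0_null_sets)
    qed
    finally have "\<forall>\<^sub>F N in sequentially. measure \<mu> (?E N) < (1/2) ^ k"
      by (rule order_tendstoD) auto
    then show "\<exists>F\<in>small_families D m ((1/2) ^ k).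
          measure \<mu> {x. orth_proj V x \<notin> ball_union F} < (1/2) ^ k"
      using B(2) by (auto simp: eventually_sequentially)
  next
    assume "\<forall>k. \<exists>F\<in>small_families D m ((1/2) ^ k).
          measure \<mu> {x. orth_proj V x \<notin> ball_union F} < (1/2) ^ k"
    then obtain F where F: "\<And>k. F k \<in> small_families D m ((1/2) ^ k)"
      "\<And>k. measure \<mu> {x. orth_proj V x \<notin> ball_union (F k)} < (1/2) ^ k" by metis
    let ?Z = "\<Inter>j. \<Union>k. ball_union (F (k + j))"
    have ZB: "?Z \<in> sets borel" by (intro sets.countable_INT sets.countable_UN) auto
    \<comment> \<open>The mass missed by a tail union is at most the mass missed by each of its
      members, hence below \<open>(1/2) ^ k\<close> for every \<open>k \<ge> j\<close>.\<close>
    have "{x. orth_proj V x \<notin> (\<Union>k. ball_union (F (k + j)))} \<in> null_sets \<mu>" (is "?E \<in> _") for j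
    proof -
      have E: "?E \<in> sets \<mu>" by (intro M sets.countable_UN) auto
      have "measure \<mu> ?E \<le> 0"
      proof (rule LIMSEQ_le_const)
        show "(\<lambda>j. (1/2::real) ^ j) \<longlonglongrightarrow> 0" by (intro LIMSEQ_power_zero) auto
        show "\<exists>N. \<forall>k\<ge>N. measure \<mu> ?E \<le> (1/2) ^ k"
        proof (intro exI allI impI)
          fix k assume k: "j \<le> k"
          have "measure \<mu> ?E \<le> measure \<mu> {x. orth_proj V x \<notin> ball_union (F k)}"
            using k by (intro finite_measure_mono M) (auto dest: spec[of _ "k - j"])
          then show "measure \<mu> ?E \<le> (1/2) ^ k" using F(2)[of k] by simp
        qed
      qed
      then show ?thesis using E by (simp add: measure_le_0_iff emeasure_eq_measure null_sets_def)
    qed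
    then have "(\<Union>j. {x. orth_proj V x \<notin> (\<Union>k. ball_union (F (k + j)))}) \<in> null_sets \<mu>"
      by auto
    moreover have "(\<Union>j. {x. orth_proj V x \<notin> (\<Union>k. ball_union (F (k + j)))}) = {x. orth_proj V x \<notin> ?Z}"
      by auto
    ultimately show "\<exists>A\<in>sets borel. hausdorff_outer m A = 0 \<and> {x. orth_proj V x \<notin> A} \<in> null_sets \<mu>"
      using ZB hausdorff_outer_limsup_eq_0[OF m F(1)] by (intro bexI[of _ ?Z]) auto
  qed
qed

section \<open>Measurability on the Grassmannian\<close>

lemma space_grass_borel [simp]: "space (grass_borel m) = grassmannian m"
  by (simp add: grass_borel_def space_measure_of_conv)

lemma sets_grass_borel_openin:
  assumes "openin (Metric_space.mtopology (grassmannian m) grass_dist) U"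
  shows "U \<in> sets (grass_borel m)"
proof -
  have "{U. openin (Metric_space.mtopology (grassmannian m) grass_dist) U} \<subseteq> Pow (grassmannian m)"
    using Metric_space.openin_mtopology[OF Metric_space_grassmannian] by blast
  then show ?thesis
    unfolding grass_borel_def using assms by (subst sets_measure_of) (auto intro: sigma_sets.Basic)
qed

lemma orth_proj_grass_dist:
  assumes "subspace V" "subspace W"
  shows "norm (orth_proj V x - orth_proj W x) \<le> grass_dist V W * norm x"
  unfolding grass_dist_onorm[OF assms]
  by (intro onorm bounded_linear_sub bounded_linear_orth_proj assms)

lemma measurable_orth_proj_left: "(\<lambda>V. orth_proj V x) \<in> grass_borel m \<rightarrow>\<^sub>M borel"
proof (rule borel_measurableI)
  fix S :: "'a set" assume S: "open S"
  let ?T = "(\<lambda>V. orth_proj V x) -` S \<inter> space (grass_borel m)"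
  interpret Metric_space "grassmannian m :: 'a set set" grass_dist by (rule Metric_space_grassmannian)
  have "openin mtopology ?T"
    unfolding openin_mtopology
  proof (intro conjI allI impI)
    fix V assume V: "V \<in> ?T"
    then obtain e where e: "0 < e" "ball (orth_proj V x) e \<subseteq> S"
      using S by (auto simp: open_contains_ball)
    \<comment> \<open>Adding 1 keeps the denominator positive when \<open>x = 0\<close>.\<close>
    have "mball V (e / (norm x + 1)) \<subseteq> ?T"
    proof
      fix W assume W: "W \<in> mball V (e / (norm x + 1))"
      have "dist (orth_proj V x) (orth_proj W x) \<le> grass_dist V W * norm x"
        using V W unfolding dist_norm
        by (intro orth_proj_grass_dist) (auto simp: in_mball, auto simp: grassmannian_def)
      also have "\<dots> \<le> grass_dist V W * (norm x + 1)"
        by (intro mult_left_mono) (auto simp: grass_dist_def)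
      also have "\<dots> < e"
      proof -
        have "0 < norm x + 1" by (simp add: add_nonneg_pos)
        moreover have "grass_dist V W < e / (norm x + 1)" using W by (simp add: in_mball)
        ultimately show ?thesis by (simp only: pos_less_divide_eq)
      qed
      finally show "W \<in> ?T" using e W by auto
    qed
    then show "\<exists>r>0. mball V r \<subseteq> ?T"
      using e by (intro exI[of _ "e / (norm x + 1)"]) (simp add: add_nonneg_pos)
  qed auto
  then show "?T \<in> sets (grass_borel m)" by (rule sets_grass_borel_openin)
qed

text \<open>Linearity in \<open>x\<close> reduces joint measurability to finitely many functions of
  \<open>V\<close> alone, the projections of the basis vectors, with coordinates of \<open>x\<close>
  as coefficients.\<close>

lemma measurable_orth_proj_pair:
  "(\<lambda>(V, x :: 'a::euclidean_space). orth_proj V x) \<in> grass_borel m \<Otimes>\<^sub>M borel \<rightarrow>\<^sub>M borel"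
proof -
  have eq: "(\<Sum>b\<in>Basis. (snd p \<bullet> b) *\<^sub>R orth_proj (fst p) b) = (case p of (V, x) \<Rightarrow> orth_proj V x)"
    if "p \<in> space (grass_borel m \<Otimes>\<^sub>M borel)" for p :: "'a set \<times> 'a"
  proof -
    obtain V x where p: "p = (V, x)" by force
    have V: "subspace V" using that by (auto simp: p space_pair_measure grassmannian_def)
    have "orth_proj V x = orth_proj V (\<Sum>b\<in>Basis. (x \<bullet> b) *\<^sub>R b)"
      by (simp add: euclidean_representation)
    then show ?thesis
      by (simp add: p linear_sum[OF linear_orth_proj[OF V]] linear_cmul[OF linear_orth_proj[OF V]])
  qed
  have L[measurable]: "(\<lambda>p. orth_proj (fst p) b) \<in> grass_borel m \<Otimes>\<^sub>M (borel :: 'a measure) \<rightarrow>\<^sub>M borel" for b :: 'a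
    by (rule measurable_compose[OF measurable_fst measurable_orth_proj_left])
  have "(\<lambda>p :: 'a set \<times> 'a. \<Sum>b\<in>Basis. (snd p \<bullet> b) *\<^sub>R orth_proj (fst p) b) \<in> grass_borel m \<Otimes>\<^sub>M borel \<rightarrow>\<^sub>M borel"
    by measurable
  then show ?thesis using eq by (simp cong: measurable_cong)
qed

lemma measurable_orth_proj_pair':
  assumes "sets M = sets (grass_borel m)" "sets N = sets borel"
  shows "(\<lambda>p. orth_proj (fst p) (snd p)) \<in> M \<Otimes>\<^sub>M N \<rightarrow>\<^sub>M borel"
  using measurable_orth_proj_pair
  by (simp only: measurable_cong_sets[OF sets_pair_measure_cong[OF assms] refl] case_prod_beta')

text \<open>The criterion by families uses only a quantifier over the naturals and one over a
  countable set, applied to masses that depend measurably on \<open>V\<close> by Fubini.\<close>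

lemma sets_proj_measure_ac_null:
  fixes \<mu> :: "'a::euclidean_space measure"
  assumes m: "0 < m" and \<mu>: "finite_measure \<mu>" "sets \<mu> = sets borel"
  shows "{V \<in> grassmannian m. proj_measure_ac m V \<mu> = null_measure (restrict_space borel V)}
    \<in> sets (grass_borel m)"
proof -
  interpret finite_measure \<mu> by fact
  obtain D :: "'a set" where D: "countable D" "\<And>X. open X \<Longrightarrow> X \<noteq> {} \<Longrightarrow> \<exists>d\<in>D. d \<in> X"
    using countable_dense_setE by blast
  have [measurable]: "(\<lambda>V. measure \<mu> {x. orth_proj V x \<notin> ball_union F}) \<in> borel_measurable (grass_borel m)" for F
  proof -
    have [measurable]: "(\<lambda>p. orth_proj (fst p) (snd p)) \<in> grass_borel m \<Otimes>\<^sub>M \<mu> \<rightarrow>\<^sub>M borel"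
      by (rule measurable_orth_proj_pair'[OF refl \<mu>(2)])
    have sp: "space \<mu> = UNIV" using sets_eq_imp_space_eq[OF \<mu>(2)] by simp
    have [measurable]: "ball_union F \<in> sets borel" by auto
    have "{p \<in> space (grass_borel m \<Otimes>\<^sub>M \<mu>). orth_proj (fst p) (snd p) \<notin> ball_union F}
        \<in> sets (grass_borel m \<Otimes>\<^sub>M \<mu>)" (is "?Q \<in> _")
      by measurable
    then have "(\<lambda>V. emeasure \<mu> (Pair V -` ?Q)) \<in> borel_measurable (grass_borel m)"
      by (rule measurable_emeasure_Pair)
    then have "(\<lambda>V. measure \<mu> (Pair V -` ?Q)) \<in> borel_measurable (grass_borel m)"
      unfolding measure_def by measurable
    moreover have "measure \<mu> (Pair V -` ?Q) = measure \<mu> {x. orth_proj V x \<notin> ball_union F}"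
      if "V \<in> space (grass_borel m)" for V
      using that by (intro arg_cong[where f = "measure \<mu>"]) (auto simp: space_pair_measure sp)
    ultimately show ?thesis
      by (rule measurable_cong[THEN iffD1, rotated])
  qed
  have [measurable]: "countable (small_families D m e)" for e
    using D(1) by (rule countable_small_families)
  have "{V \<in> space (grass_borel m). \<forall>k. \<exists>F\<in>small_families D m ((1/2) ^ k).
          measure \<mu> {x. orth_proj V x \<notin> ball_union F} < (1/2) ^ k} \<in> sets (grass_borel m)"
    by measurable
  also have "{V \<in> space (grass_borel m). \<forall>k. \<exists>F\<in>small_families D m ((1/2) ^ k).
          measure \<mu> {x. orth_proj V x \<notin> ball_union F} < (1/2) ^ k}
      = {V \<in> grassmannian m. proj_measure_ac m V \<mu> = null_measure (restrict_space borel V)}"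
    using proj_measure_ac_eq_null_iff[OF m _ \<mu> D(2)] by (auto simp: grassmannian_def)
  finally show ?thesis .
qed

section \<open>The measure of the subspaces almost orthogonal to a vector\<close>

text \<open>The index of the cell of side \<open>r\<close> containing \<open>x\<close>, in
  coordinates along \<open>B\<close>. It is extensional outside \<open>B\<close>, so that indices
  can be counted in a finite \<open>PiE\<close>.\<close>

definition grid :: "'a::real_inner set \<Rightarrow> real \<Rightarrow> 'a \<Rightarrow> 'a \<Rightarrow> int" where
  "grid B r x = (\<lambda>b\<in>B. \<lfloor>(b \<bullet> x) / r\<rfloor>)"

text \<open>Each coordinate runs through an interval of length \<open>2 * \<rho>\<close>, which
  meets at most \<open>2 * \<rho> / r + 2\<close> cells, and \<open>r \<le> \<rho>\<close> absorbs
  the 2 into \<open>4 * \<rho> / r\<close>.\<close>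

lemma card_grid_cball:
  assumes B: "finite B" "\<And>b. b \<in> B \<Longrightarrow> norm b = 1" and r: "0 < r" "r \<le> \<rho>"
  shows "finite (grid B r ` cball c \<rho>)" "real (card (grid B r ` cball c \<rho>)) \<le> (4 * \<rho> / r) ^ card B"
proof -
  define l u where "l b = \<lfloor>(b \<bullet> c - \<rho>) / r\<rfloor>" and "u b = \<lfloor>(b \<bullet> c + \<rho>) / r\<rfloor>" for b
  have sub: "grid B r ` cball c \<rho> \<subseteq> PiE B (\<lambda>b. {l b..u b})"
  proof clarify
    fix x assume x: "x \<in> cball c \<rho>"
    have "\<lfloor>(b \<bullet> x) / r\<rfloor> \<in> {l b..u b}" if b: "b \<in> B" for b
    proof -
      have "\<bar>b \<bullet> (x - c)\<bar> \<le> norm b * norm (x - c)" by (rule Cauchy_Schwarz_ineq2)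
      also have "\<dots> \<le> \<rho>" using x B(2)[OF b] by (simp add: dist_norm norm_minus_commute)
      finally have "b \<bullet> c - \<rho> \<le> b \<bullet> x" "b \<bullet> x \<le> b \<bullet> c + \<rho>"
        by (auto simp: inner_diff_right abs_le_iff)
      then show ?thesis using r by (auto simp: l_def u_def intro!: floor_mono divide_right_mono)
    qed
    then show "grid B r x \<in> PiE B (\<lambda>b. {l b..u b})" by (auto simp: grid_def PiE_def)
  qed
  have fin: "finite (PiE B (\<lambda>b. {l b..u b}))" using B(1) by (intro finite_PiE) auto
  then show "finite (grid B r ` cball c \<rho>)" using sub by (rule finite_subset[rotated])
  have "real (card (grid B r ` cball c \<rho>)) \<le> real (card (PiE B (\<lambda>b. {l b..u b})))"
    using card_mono[OF fin sub] by simp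
  also have "\<dots> = (\<Prod>b\<in>B. real (card {l b..u b}))"
    using B(1) by (simp add: card_PiE)
  also have "\<dots> \<le> (\<Prod>b\<in>B. 4 * \<rho> / r)"
  proof (rule prod_mono)
    fix b
    have "real_of_int (u b - l b + 1) \<le> (b \<bullet> c + \<rho>) / r - (b \<bullet> c - \<rho>) / r + 2"
      unfolding u_def l_def by linarith
    also have "\<dots> = 2 * \<rho> / r + 2" by (simp add: diff_divide_distrib add_divide_distrib)
    also have "\<dots> \<le> 4 * \<rho> / r" using r by (simp add: field_simps)
    finally have "real_of_int (u b - l b + 1) \<le> 4 * \<rho> / r" .
    moreover have "0 \<le> 4 * \<rho> / r" using r by simp
    ultimately show "0 \<le> real (card {l b..u b}) \<and> real (card {l b..u b}) \<le> 4 * \<rho> / r"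
      by (simp add: nat_le_real_less of_nat_nat)
  qed
  also have "\<dots> = (4 * \<rho> / r) ^ card B" by simp
  finally show "real (card (grid B r ` cball c \<rho>)) \<le> (4 * \<rho> / r) ^ card B" .
qed

lemma orth_proj_orthonormal:
  assumes B: "finite B" "pairwise orthogonal B" "\<And>b. b \<in> B \<Longrightarrow> norm b = 1"
  shows "orth_proj (span B) x = (\<Sum>b\<in>B. (b \<bullet> x) *\<^sub>R b)"
proof (rule orth_proj_unique)
  show "(\<Sum>b\<in>B. (b \<bullet> x) *\<^sub>R b) \<in> span B" by (intro span_sum span_scale span_base)
  fix w assume w: "w \<in> span B"
  have "orthogonal (x - (\<Sum>b\<in>B. (b \<bullet> x) *\<^sub>R b)) a" if a: "a \<in> B" for a
  proof -
    have "(\<Sum>b\<in>B. (b \<bullet> x) * (b \<bullet> a)) = (\<Sum>b\<in>B. if b = a then a \<bullet> x else 0)"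
      using B a by (intro sum.cong) (auto simp: pairwise_def orthogonal_def dot_square_norm)
    also have "\<dots> = a \<bullet> x" using B(1) a by simp
    finally show ?thesis
      by (simp add: orthogonal_def inner_diff_left inner_sum_left inner_commute[of x a])
  qed
  then show "orthogonal (x - (\<Sum>b\<in>B. (b \<bullet> x) *\<^sub>R b)) w"
    by (rule orthogonal_to_span[OF w])
qed simp

text \<open>Points in one cell differ by at most \<open>r\<close> in each coordinate. The crude
  triangle inequality over the coordinates produces the factor \<open>card B\<close>, which later
  fixes the radius \<open>real m / real (Suc k)\<close> for the scale
  \<open>1 / real (Suc k)\<close>.\<close>

lemma grid_eq_imp_norm_orth_proj_le:
  assumes B: "finite B" "pairwise orthogonal B" "\<And>b. b \<in> B \<Longrightarrow> norm b = 1"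
    and r: "0 < r" and eq: "grid B r x = grid B r y"
  shows "norm (orth_proj (span B) (x - y)) \<le> real (card B) * r"
proof -
  have "norm ((b \<bullet> (x - y)) *\<^sub>R b) \<le> r" if b: "b \<in> B" for b
  proof -
    have "\<lfloor>(b \<bullet> x) / r\<rfloor> = \<lfloor>(b \<bullet> y) / r\<rfloor>"
      using fun_cong[OF eq, of b] b by (simp add: grid_def)
    then have "\<bar>(b \<bullet> x) / r - (b \<bullet> y) / r\<bar> \<le> 1" by linarith
    also have "(b \<bullet> x) / r - (b \<bullet> y) / r = (b \<bullet> (x - y)) / r"
      by (simp add: inner_diff_right diff_divide_distrib)
    finally show ?thesis using r B(3)[OF b] by (simp add: abs_divide)
  qed
  then have "(\<Sum>b\<in>B. norm ((b \<bullet> (x - y)) *\<^sub>R b)) \<le> (\<Sum>b\<in>B. r)" by (rule sum_mono)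
  from order_trans[OF norm_sum this] show ?thesis by (simp add: orth_proj_orthonormal[OF B])
qed

lemma orth_proj_orthogonal_comp:
  assumes "subspace V"
  shows "orth_proj (orthogonal_comp V) x = x - orth_proj V x"
proof (rule orth_proj_unique)
  show "x - orth_proj V x \<in> orthogonal_comp V"
    using orth_proj_props(2)[OF assms] by (auto simp: orthogonal_comp_def orthogonal_commute)
  show "orthogonal (x - (x - orth_proj V x)) w" if "w \<in> orthogonal_comp V" for w
    using that orth_proj_props(1)[OF assms] by (auto simp: orthogonal_comp_def)
qed (rule subspace_orthogonal_comp)

text \<open>The slab is thin in the \<open>dim V\<close> directions of \<open>V\<close>. A grid of
  side \<open>s\<close> in the orthogonal complement needs at most \<open>(4 / s) ^ card B\<close>
  cells, and the part over each cell fits in a ball of volume of order \<open>s ^ DIM('a)\<close>;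
  the quotient leaves \<open>s ^ dim V\<close>.\<close>

lemma emeasure_slab_le:
  fixes V :: "'a::euclidean_space set"
  assumes V: "subspace V" and s: "0 < s" "s \<le> 1"
  shows "emeasure lborel {z \<in> cball 0 1. norm (orth_proj V z) \<le> s}
    \<le> ennreal ((4 * (real DIM('a) + 2)) ^ DIM('a) * unit_ball_vol (real DIM('a)) * s ^ dim V)"
proof -
  let ?n = "DIM('a)" and ?S = "{z \<in> cball 0 1. norm (orth_proj V z) \<le> s}"
  obtain B where B: "pairwise orthogonal B" "\<And>b. b \<in> B \<Longrightarrow> norm b = 1" "independent B"
      "card B = dim (orthogonal_comp V)" "span B = orthogonal_comp V"
    using orthonormal_basis_subspace[OF subspace_orthogonal_comp[of V]] by metis
  have fB: "finite B" using B(3) by (rule independent_imp_finite)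
  have cB: "card B + dim V = ?n"
    using dim_subspace_orthogonal_to_vectors[OF V subspace_UNIV] B(4)
    by (simp add: orthogonal_comp_def orthogonal_commute)
  define p where "p q = (SOME z. z \<in> ?S \<and> grid B s z = q)" for q
  have p: "p q \<in> ?S \<and> grid B s (p q) = q" if "q \<in> grid B s ` ?S" for q
    using that unfolding p_def by (intro someI_ex[of "\<lambda>z. z \<in> ?S \<and> grid B s z = q"]) auto
  have G: "finite (grid B s ` ?S)" "real (card (grid B s ` ?S)) \<le> (4 / s) ^ card B"
  proof -
    have sub: "grid B s ` ?S \<subseteq> grid B s ` cball 0 1" by auto
    note c = card_grid_cball[OF fB B(2) s, of 0]
    show "finite (grid B s ` ?S)" using finite_subset[OF sub c(1)] by simp
    show "real (card (grid B s ` ?S)) \<le> (4 / s) ^ card B"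
      using card_mono[OF c(1) sub] c(2) by simp
  qed
  \<comment> \<open>Two slab points over one cell differ by at most \<open>card B * s\<close> along
    the complement and by \<open>s + s\<close> along \<open>V\<close>.\<close>
  let ?R = "(real ?n + 2) * s"
  have "?S \<subseteq> (\<Union>q\<in>grid B s ` ?S. cball (p q) ?R)"
  proof
    fix z assume z: "z \<in> ?S"
    define w where "w = p (grid B s z)"
    have w: "w \<in> ?S" "grid B s w = grid B s z" using p z by (auto simp: w_def)
    have "norm (orth_proj (span B) (w - z)) \<le> real (card B) * s"
      by (rule grid_eq_imp_norm_orth_proj_le) (use fB B s w in auto)
    then have "norm ((w - z) - (orth_proj V w - orth_proj V z)) \<le> real (card B) * s"
      by (simp add: B(5) orth_proj_orthogonal_comp[OF V] linear_diff[OF linear_orth_proj[OF V]])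
    moreover have "norm (orth_proj V w) \<le> s" "norm (orth_proj V z) \<le> s" using w z by auto
    ultimately have "norm (w - z) \<le> real (card B) * s + (s + s)"
      using norm_triangle_ineq2[of "w - z" "orth_proj V w - orth_proj V z"]
        norm_triangle_ineq4[of "orth_proj V w" "orth_proj V z"] by linarith
    also have "\<dots> \<le> ?R" using cB s by (simp add: distrib_right mult_right_mono)
    finally show "z \<in> (\<Union>q\<in>grid B s ` ?S. cball (p q) ?R)"
      using z by (auto simp: w_def dist_norm)
  qed
  moreover have "(\<Union>q\<in>grid B s ` ?S. cball (p q) ?R) \<in> sets lborel"
    by (rule sets.finite_UN[OF G(1)]) auto
  ultimately have "emeasure lborel ?S \<le> emeasure lborel (\<Union>q\<in>grid B s ` ?S. cball (p q) ?R)"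
    by (rule emeasure_mono)
  also have "\<dots> \<le> (\<Sum>q\<in>grid B s ` ?S. emeasure lborel (cball (p q) ?R))"
    using G(1) by (intro emeasure_subadditive_finite) auto
  also have "\<dots> = ennreal (real (card (grid B s ` ?S)) * (unit_ball_vol (real ?n) * ?R ^ ?n))"
    using s by (simp add: emeasure_cball ennreal_mult ennreal_of_nat_eq_real_of_nat)
  also have "\<dots> \<le> ennreal ((4 * (real ?n + 2)) ^ ?n * unit_ball_vol (real ?n) * s ^ dim V)"
  proof (rule ennreal_leI)
    have "real (card (grid B s ` ?S)) * (unit_ball_vol (real ?n) * ?R ^ ?n)
        \<le> (4 / s) ^ card B * (unit_ball_vol (real ?n) * ?R ^ ?n)"
      using G(2) s by (intro mult_right_mono) auto
    also have "\<dots> = 4 ^ card B * (real ?n + 2) ^ ?n * unit_ball_vol (real ?n) * s ^ dim V"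
    proof -
      have "s ^ ?n = s ^ card B * s ^ dim V" by (simp flip: cB add: power_add)
      then show ?thesis using s by (simp add: power_mult_distrib power_divide)
    qed
    also have "\<dots> \<le> 4 ^ ?n * (real ?n + 2) ^ ?n * unit_ball_vol (real ?n) * s ^ dim V"
      using cB s by (intro mult_right_mono power_increasing) auto
    finally show "real (card (grid B s ` ?S)) * (unit_ball_vol (real ?n) * ?R ^ ?n)
        \<le> (4 * (real ?n + 2)) ^ ?n * unit_ball_vol (real ?n) * s ^ dim V"
      by (simp only: power_mult_distrib)
  qed
  finally show ?thesis .
qed

section \<open>Orthogonal invariance and averaging over directions\<close>

lemma orth_proj_image:
  assumes g: "orthogonal_transformation g" and V: "subspace V"
  shows "orth_proj (g ` V) (g x) = g (orth_proj V x)"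
proof (rule orth_proj_unique)
  have l: "linear g" using g by (rule orthogonal_transformation_linear)
  show "subspace (g ` V)" using l V by (rule linear_subspace_image)
  show "g (orth_proj V x) \<in> g ` V" using orth_proj_props(1)[OF V] by auto
  fix w assume "w \<in> g ` V"
  then obtain v where v: "v \<in> V" "w = g v" by auto
  have "orthogonal (x - orth_proj V x) v" using orth_proj_props(2)[OF V v(1)] .
  then show "orthogonal (g x - g (orth_proj V x)) w"
    using g by (simp add: v orthogonal_def linear_diff[OF l, symmetric] orthogonal_transformation_def)
qed

lemma grassmannian_image:
  assumes g: "orthogonal_transformation g" and V: "V \<in> grassmannian m"
  shows "g ` V \<in> grassmannian m"
proof -
  have l: "linear g" using g by (rule orthogonal_transformation_linear)
  have "subspace (g ` V)"
    using V l by (intro linear_subspace_image) (auto simp: grassmannian_def)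
  moreover have "dim (g ` V) = dim V"
    by (rule dim_image_eq[OF l inj_on_subset[OF orthogonal_transformation_inj[OF g]]]) simp
  ultimately show ?thesis using V by (simp add: grassmannian_def)
qed

lemma sets_norm_orth_proj_le:
  "{V \<in> grassmannian m. norm (orth_proj V x) \<le> t} \<in> sets (grass_borel m)"
proof -
  note [measurable] = measurable_orth_proj_left
  have "{V \<in> space (grass_borel m). norm (orth_proj V x) \<le> t} \<in> sets (grass_borel m)" by measurable
  then show ?thesis by simp
qed

text \<open>By invariance the left-hand side does not depend on \<open>z\<close>, so it may be averaged over the
  unit ball; after exchanging the integrals the estimate is about a fixed \<open>V\<close>.\<close>

lemma grass_measure_small_projection_le:
  fixes \<gamma> :: "(real ^ 'n) set measure"
  assumes \<gamma>: "grass_invariant_measure m \<gamma>" and s: "0 < s" and z: "z \<noteq> 0"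
  shows "emeasure \<gamma> {V \<in> grassmannian m. norm (orth_proj V z) \<le> s * norm z}
    \<le> ennreal ((4 * (real CARD('n) + 2)) ^ CARD('n) * s ^ m)"
proof -
  define f where "f z = emeasure \<gamma> {V \<in> grassmannian m. norm (orth_proj V z) \<le> s * norm z}" for z :: "real ^ 'n"
  let ?n = "CARD('n)" and ?K = "(4 * (real CARD('n) + 2)) ^ CARD('n)"
  note \<gamma>' = \<gamma>[unfolded grass_invariant_measure_def]
  have sets: "sets \<gamma> = sets (grass_borel m)" by (rule \<gamma>'[THEN conjunct1])
  have P: "prob_space \<gamma>" by (rule \<gamma>'[THEN conjunct2, THEN conjunct1])
  note inv = \<gamma>'[THEN conjunct2, THEN conjunct2, rule_format]
  have sp: "space \<gamma> = grassmannian m" using sets_eq_imp_space_eq[OF sets] by simp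
  interpret prob_space \<gamma> by fact
  have A: "{V \<in> grassmannian m. norm (orth_proj V x) \<le> t} \<in> sets \<gamma>" for x t
    unfolding sets by (rule sets_norm_orth_proj_le)
  \<comment> \<open>An inequality suffices, since only an upper bound for \<open>f z\<close> by
    every \<open>f x\<close> is needed.\<close>
  have rot: "f x \<le> f y" if xy: "norm x = norm y" for x y
  proof -
    obtain g where g: "orthogonal_transformation g" "g x = y"
      using orthogonal_transformation_exists[OF xy] by blast
    have "f x = emeasure \<gamma> ((\<lambda>V. g ` V) ` {V \<in> grassmannian m. norm (orth_proj V x) \<le> s * norm x})"
      unfolding f_def by (rule inv[OF g(1) A, symmetric])
    also have "\<dots> \<le> f y" unfolding f_def
    proof (intro emeasure_mono A)
      show "(\<lambda>V. g ` V) ` {V \<in> grassmannian m. norm (orth_proj V x) \<le> s * norm x}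
          \<subseteq> {V \<in> grassmannian m. norm (orth_proj V y) \<le> s * norm y}"
      proof clarify
        fix V assume V: "V \<in> grassmannian m" "norm (orth_proj V x) \<le> s * norm x"
        have "orth_proj (g ` V) y = g (orth_proj V x)"
          using orth_proj_image[OF g(1)] V g(2) by (auto simp: grassmannian_def)
        then show "g ` V \<in> grassmannian m \<and> norm (orth_proj (g ` V) y) \<le> s * norm y"
          using V xy grassmannian_image[OF g(1) V(1)] g(1) by (simp add: orthogonal_transformation_norm)
      qed
    qed
    finally show ?thesis .
  qed
  have scale: "f (c *\<^sub>R x) = f x" if "0 < c" for c x
  proof -
    have "norm (orth_proj V (c *\<^sub>R x)) \<le> s * norm (c *\<^sub>R x) \<longleftrightarrow> norm (orth_proj V x) \<le> s * norm x"
      if V: "V \<in> grassmannian m" for V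
    proof -
      have "orth_proj V (c *\<^sub>R x) = c *\<^sub>R orth_proj V x"
        using V by (intro linear_cmul linear_orth_proj) (auto simp: grassmannian_def)
      then show ?thesis using \<open>0 < c\<close> by (simp add: mult.left_commute)
    qed
    then show ?thesis unfolding f_def by (intro arg_cong[where f = "emeasure \<gamma>"]) auto
  qed
  have const: "f z \<le> f x" for x
  proof (cases "x = 0")
    case True
    have "f x = emeasure \<gamma> (space \<gamma>)"
      unfolding f_def using True linear_0[OF linear_orth_proj]
      by (intro arg_cong[where f = "emeasure \<gamma>"]) (auto simp: sp grassmannian_def)
    then show ?thesis by (simp add: f_def emeasure_space)
  next
    case False
    have "f z = f ((norm x / norm z) *\<^sub>R z)" using False z by (intro scale[symmetric]) simp
    also have "\<dots> \<le> f x" using z by (intro rot) simp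
    finally show ?thesis .
  qed
  show ?thesis
  proof (cases "s \<le> 1")
    \<comment> \<open>The slab estimate requires \<open>s \<le> 1\<close>; for larger
      \<open>s\<close> the claimed bound already exceeds the total mass 1.\<close>
    case False
    have "f z \<le> 1" by (simp add: f_def emeasure_le_1)
    also have "1 = ennreal (1 * 1)" by simp
    also have "\<dots> \<le> ennreal (?K * s ^ m)"
    proof (intro ennreal_leI mult_mono)
      show "1 \<le> ?K" by (rule one_le_power) simp
      show "1 \<le> s ^ m" using False by (intro one_le_power) simp
    qed auto
    finally show ?thesis by (simp add: f_def)
  next
    case True
    interpret pair_sigma_finite \<gamma> "lborel :: (real ^ 'n) measure" ..
    define Q where "Q = {p \<in> space (\<gamma> \<Otimes>\<^sub>M lborel). norm (snd p :: real ^ 'n) \<le> 1 \<and>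
        norm (orth_proj (fst p) (snd p)) \<le> s * norm (snd p)}"
    have [measurable]: "snd \<in> \<gamma> \<Otimes>\<^sub>M (lborel :: (real ^ 'n) measure) \<rightarrow>\<^sub>M borel"
      using measurable_snd[of \<gamma> lborel] by (simp only: measurable_cong_sets[OF refl sets_lborel])
    have [measurable]: "(\<lambda>p. orth_proj (fst p) (snd p)) \<in> \<gamma> \<Otimes>\<^sub>M (lborel :: (real ^ 'n) measure) \<rightarrow>\<^sub>M borel"
      by (rule measurable_orth_proj_pair'[OF sets sets_lborel])
    have Q: "Q \<in> sets (\<gamma> \<Otimes>\<^sub>M lborel)" unfolding Q_def by measurable
    have "f z * ennreal (unit_ball_vol (real ?n)) = (\<integral>\<^sup>+x. f z * indicator (cball (0 :: real ^ 'n) 1) x \<partial>lborel)"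
      by (simp add: nn_integral_cmult_indicator emeasure_cball)
    also have "\<dots> \<le> (\<integral>\<^sup>+x. emeasure \<gamma> ((\<lambda>V. (V, x)) -` Q) \<partial>lborel)"
    proof (rule nn_integral_mono)
      fix x :: "real ^ 'n"
      have "(\<lambda>V. (V, x)) -` Q = {V \<in> grassmannian m. norm (orth_proj V x) \<le> s * norm x}" if "x \<in> cball 0 1"
        using that by (auto simp: Q_def space_pair_measure sp)
      then show "f z * indicator (cball 0 1) x \<le> emeasure \<gamma> ((\<lambda>V. (V, x)) -` Q)"
        using const[of x] by (auto simp: f_def indicator_def)
    qed
    also have "\<dots> = emeasure (\<gamma> \<Otimes>\<^sub>M lborel) Q"
      by (rule emeasure_pair_measure_alt2[OF Q, symmetric])
    also have "\<dots> = (\<integral>\<^sup>+V. emeasure lborel (Pair V -` Q) \<partial>\<gamma>)"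
      by (rule lborel.emeasure_pair_measure_alt[OF Q])
    also have "\<dots> \<le> (\<integral>\<^sup>+V. ennreal (?K * unit_ball_vol (real ?n) * s ^ m) \<partial>\<gamma>)"
    proof (rule nn_integral_mono)
      fix V assume "V \<in> space \<gamma>"
      then have V: "subspace V" "dim V = m" by (auto simp: sp grassmannian_def)
      have "Pair V -` Q \<subseteq> {z \<in> cball 0 1. norm (orth_proj V z) \<le> s}"
      proof
        fix x assume "x \<in> Pair V -` Q"
        then have x: "norm x \<le> 1" "norm (orth_proj V x) \<le> s * norm x" by (auto simp: Q_def)
        have "s * norm x \<le> s * 1" using s x by (intro mult_left_mono) auto
        then show "x \<in> {z \<in> cball 0 1. norm (orth_proj V z) \<le> s}" using x by simp
      qed
      moreover have "{z \<in> cball 0 1. norm (orth_proj V z) \<le> s} \<in> sets lborel"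
      proof -
        have [measurable]: "orth_proj V \<in> borel_measurable borel"
          by (intro borel_measurable_continuous_onI linear_continuous_on bounded_linear_orth_proj V)
        have "{z \<in> space borel. norm z \<le> 1 \<and> norm (orth_proj V z) \<le> s} \<in> sets borel" by measurable
        then show ?thesis by simp
      qed
      ultimately have "emeasure lborel (Pair V -` Q)
          \<le> emeasure lborel {z \<in> cball 0 1. norm (orth_proj V z) \<le> s}"
        by (rule emeasure_mono)
      also have "\<dots> \<le> ennreal (?K * unit_ball_vol (real ?n) * s ^ m)"
        using emeasure_slab_le[OF V(1) s True] V(2) by simp
      finally show "emeasure lborel (Pair V -` Q) \<le> ennreal (?K * unit_ball_vol (real ?n) * s ^ m)" .
    qed
    also have "\<dots> = ennreal (?K * unit_ball_vol (real ?n) * s ^ m)" by (simp add: emeasure_space_1)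
    also have "\<dots> = ennreal (?K * s ^ m) * ennreal (unit_ball_vol (real ?n))"
      using s by (simp flip: ennreal_mult add: ac_simps)
    finally have le: "ennreal (unit_ball_vol (real ?n)) * f z \<le> ennreal (unit_ball_vol (real ?n)) * ennreal (?K * s ^ m)"
      by (simp only: mult.commute)
    have "0 < unit_ball_vol (real ?n)" by (rule unit_ball_vol_pos) simp
    then have nz: "ennreal (unit_ball_vol (real ?n)) \<noteq> 0"
      by (metis ennreal_eq_0_iff not_le)
    show ?thesis
      using iffD1[OF ennreal_mult_le_mult_iff[OF nz ennreal_neq_top] le] unfolding f_def .
  qed
qed

section \<open>Pairs of points with close projections\<close>

lemma frequently_le_if_Liminf_finite:
  fixes u :: "'a \<Rightarrow> ennreal"
  assumes "Liminf F u \<noteq> \<infinity>" "F \<noteq> bot"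
  shows "\<exists>C::real. \<exists>\<^sub>F k in F. u k \<le> ennreal C"
proof -
  obtain C where C: "Liminf F u = ennreal C" "0 \<le> C" using assms(1) by (cases "Liminf F u") auto
  have "\<exists>\<^sub>F k in F. u k \<le> ennreal (C + 1)"
  proof (rule ccontr)
    assume "\<not> ?thesis"
    then have "\<forall>\<^sub>F k in F. ennreal (C + 1) \<le> u k"
      unfolding not_frequently by (rule eventually_mono) simp
    then have "ennreal (C + 1) \<le> Liminf F u" by (rule Liminf_bounded)
    then show False using C by (simp add: ennreal_le_iff)
  qed
  then show ?thesis ..
qed

text \<open>Fatou makes the lower limit integrable, hence finite almost everywhere. The indices at
  which the bound holds depend on the point, so only a frequent bound survives.\<close>

lemma AE_frequently_le:
  fixes u :: "nat \<Rightarrow> 'a \<Rightarrow> ennreal"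
  assumes [measurable]: "\<And>k. u k \<in> borel_measurable M"
    and le: "\<And>k. (\<integral>\<^sup>+x. u k x \<partial>M) \<le> ennreal C"
  shows "AE x in M. \<exists>C::real. \<exists>\<^sub>F k in sequentially. u k x \<le> ennreal C"
proof -
  have "(\<integral>\<^sup>+x. liminf (\<lambda>k. u k x) \<partial>M) \<le> liminf (\<lambda>k. \<integral>\<^sup>+x. u k x \<partial>M)"
    by (rule nn_integral_liminf) measurable
  also have "\<dots> \<le> ennreal C" using le by (intro Liminf_le) auto
  finally have "(\<integral>\<^sup>+x. liminf (\<lambda>k. u k x) \<partial>M) \<noteq> \<infinity>"
    by (auto simp: top_unique)
  then have "AE x in M. liminf (\<lambda>k. u k x) \<noteq> \<infinity>" by (intro nn_integral_PInf_AE) measurable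
  then show ?thesis
    by eventually_elim (intro frequently_le_if_Liminf_finite, auto)
qed

text \<open>The condition says that \<open>x - y\<close> lies in the tube of radius \<open>r\<close>
  around the orthogonal complement of \<open>V\<close>.\<close>

definition tube_pairs :: "'a::euclidean_space set \<Rightarrow> 'a set \<Rightarrow> 'a set \<Rightarrow> real \<Rightarrow> ('a \<times> 'a) set" where
  "tube_pairs A B V r = {p. fst p \<in> A \<and> snd p \<in> B \<and> norm (orth_proj V (fst p - snd p)) \<le> r}"

text \<open>Since \<open>d \<le> norm (x - y)\<close>, a projected distance of at most
  \<open>m / Suc k\<close> is a relative one of at most \<open>s = m / Suc k / d\<close>. This has
  probability of order \<open>s ^ m\<close>, and the factor \<open>real (Suc k) ^ m\<close> cancels
  the dependence on \<open>k\<close>.\<close>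

lemma AE_tube_pairs_frequently_le:
  fixes \<mu> :: "(real ^ 'n) measure"
  assumes \<gamma>: "grass_invariant_measure m \<gamma>" and \<mu>: "finite_measure \<mu>" "sets \<mu> = sets borel"
    and AB: "A \<in> sets borel" "B \<in> sets borel" and m: "0 < m"
    and d: "0 < d" "\<And>x y. x \<in> A \<Longrightarrow> y \<in> B \<Longrightarrow> d \<le> dist x y"
  shows "AE V in \<gamma>. \<exists>C. \<exists>\<^sub>F k in sequentially.
    real (Suc k) ^ m * measure (\<mu> \<Otimes>\<^sub>M \<mu>) (tube_pairs A B V (real m / real (Suc k))) \<le> C"
proof -
  let ?N = "\<mu> \<Otimes>\<^sub>M \<mu>" and ?K = "(4 * (real CARD('n) + 2)) ^ CARD('n)"
  have sets: "sets \<gamma> = sets (grass_borel m)" and P: "prob_space \<gamma>"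
    using \<gamma> by (simp_all add: grass_invariant_measure_def)
  have sp: "space \<gamma> = grassmannian m" using sets_eq_imp_space_eq[OF sets] by simp
  have sp\<mu>: "space \<mu> = UNIV" using sets_eq_imp_space_eq[OF \<mu>(2)] by simp
  interpret \<gamma>: prob_space \<gamma> by (rule P)
  interpret \<mu>: finite_measure \<mu> by (rule \<mu>)
  interpret N: finite_measure ?N by (intro finite_measure_pair_measure \<mu>)
  interpret pair_sigma_finite \<gamma> ?N ..
  note [measurable_cong] = \<mu>(2)
  note [measurable] = AB
  define Q where "Q k = {q \<in> space (\<gamma> \<Otimes>\<^sub>M ?N). fst (snd q) \<in> A \<and> snd (snd q) \<in> B \<and>
      norm (orth_proj (fst q) (fst (snd q) - snd (snd q))) \<le> real m / real (Suc k)}" for k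
  have [measurable]: "(\<lambda>q. orth_proj (fst q) (fst (snd q) - snd (snd q))) \<in> \<gamma> \<Otimes>\<^sub>M ?N \<rightarrow>\<^sub>M borel"
  proof -
    have "(\<lambda>q. (fst q, fst (snd q) - snd (snd q))) \<in> \<gamma> \<Otimes>\<^sub>M ?N \<rightarrow>\<^sub>M \<gamma> \<Otimes>\<^sub>M borel" by measurable
    from measurable_compose[OF this measurable_orth_proj_pair'[OF sets refl]] show ?thesis by simp
  qed
  have Q: "Q k \<in> sets (\<gamma> \<Otimes>\<^sub>M ?N)" for k unfolding Q_def by measurable
  have sec: "Pair V -` Q k = tube_pairs A B V (real m / real (Suc k))" if "V \<in> space \<gamma>" for V k
    using that by (auto simp: Q_def tube_pairs_def space_pair_measure sp\<mu>)
  define u where "u k V = ennreal (real (Suc k) ^ m) * emeasure ?N (Pair V -` Q k)" for k V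
  have "(\<integral>\<^sup>+V. u k V \<partial>\<gamma>) \<le> ennreal (?K * (real m / d) ^ m * measure ?N (space ?N))" for k
  proof -
    let ?s = "real m / real (Suc k) / d"
    have s: "0 < ?s" using m d by simp
    have "(\<integral>\<^sup>+V. u k V \<partial>\<gamma>) = ennreal (real (Suc k) ^ m) * (\<integral>\<^sup>+V. emeasure ?N (Pair V -` Q k) \<partial>\<gamma>)"
      unfolding u_def by (intro nn_integral_cmult N.measurable_emeasure_Pair Q)
    also have "(\<integral>\<^sup>+V. emeasure ?N (Pair V -` Q k) \<partial>\<gamma>) = emeasure (\<gamma> \<Otimes>\<^sub>M ?N) (Q k)"
      by (rule N.emeasure_pair_measure_alt[OF Q, symmetric])
    also have "\<dots> = (\<integral>\<^sup>+p. emeasure \<gamma> ((\<lambda>V. (V, p)) -` Q k) \<partial>?N)"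
      by (rule emeasure_pair_measure_alt2[OF Q])
    also have "\<dots> \<le> (\<integral>\<^sup>+p. ennreal (?K * ?s ^ m) \<partial>?N)"
    proof (rule nn_integral_mono)
      fix p assume "p \<in> space ?N"
      obtain x y where p: "p = (x, y)" by force
      show "emeasure \<gamma> ((\<lambda>V. (V, p)) -` Q k) \<le> ennreal (?K * ?s ^ m)"
      proof (cases "x \<in> A \<and> y \<in> B")
        case True
        then have dist: "d \<le> norm (x - y)" using d(2) by (simp add: dist_norm)
        have "real m / real (Suc k) \<le> ?s * norm (x - y)"
          using mult_left_mono[OF dist less_imp_le[OF s]] d(1) by simp
        then have "(\<lambda>V. (V, p)) -` Q k \<subseteq> {V \<in> grassmannian m. norm (orth_proj V (x - y)) \<le> ?s * norm (x - y)}"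
          by (auto simp: Q_def p space_pair_measure sp)
        then have "emeasure \<gamma> ((\<lambda>V. (V, p)) -` Q k)
            \<le> emeasure \<gamma> {V \<in> grassmannian m. norm (orth_proj V (x - y)) \<le> ?s * norm (x - y)}"
          by (rule emeasure_mono) (simp only: sets sets_norm_orth_proj_le)
        also have "\<dots> \<le> ennreal (?K * ?s ^ m)"
          using dist d(1) by (intro grass_measure_small_projection_le \<gamma> s) auto
        finally show ?thesis .
      next
        case False
        then have "(\<lambda>V. (V, p)) -` Q k = {}" by (auto simp: Q_def p)
        then show ?thesis by simp
      qed
    qed
    also have "\<dots> = ennreal (?K * ?s ^ m) * ennreal (measure ?N (space ?N))"
      by (simp add: N.emeasure_eq_measure)
    also have "ennreal (real (Suc k) ^ m) * \<dots> = ennreal (real (Suc k) ^ m * (?K * ?s ^ m * measure ?N (space ?N)))"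
    proof -
      have "ennreal a * (ennreal b * ennreal c) = ennreal (a * (b * c))"
        if "0 \<le> a" "0 \<le> b" "0 \<le> c" for a b c :: real
        using that by (simp add: ennreal_mult)
      then show ?thesis using s by simp
    qed
    also have "real (Suc k) ^ m * (?K * ?s ^ m * measure ?N (space ?N)) = ?K * (real (Suc k) * ?s) ^ m * measure ?N (space ?N)"
      by (simp only: power_mult_distrib mult_ac)
    also have "real (Suc k) * ?s = real m / d" by simp
    finally show ?thesis by (simp only: mult_left_mono zero_le)
  qed
  moreover have "u k \<in> borel_measurable \<gamma>" for k
    unfolding u_def by (intro borel_measurable_times_ennreal N.measurable_emeasure_Pair Q) simp
  ultimately have "AE V in \<gamma>. \<exists>C::real. \<exists>\<^sub>F k in sequentially. u k V \<le> ennreal C"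
    by (intro AE_frequently_le)
  then show ?thesis
    using AE_space
  proof eventually_elim
    case (elim V)
    then obtain C where C: "\<exists>\<^sub>F k in sequentially. u k V \<le> ennreal C" by blast
    \<comment> \<open>For negative \<open>C\<close>, \<open>ennreal C\<close> is 0, hence the
      maximum.\<close>
    have "real (Suc k) ^ m * measure ?N (tube_pairs A B V (real m / real (Suc k))) \<le> max C 0"
      if "u k V \<le> ennreal C" for k
    proof -
      have "u k V = ennreal (real (Suc k) ^ m * measure ?N (tube_pairs A B V (real m / real (Suc k))))"
        unfolding u_def sec[OF elim(2)] N.emeasure_eq_measure by (simp add: ennreal_mult)
      then show ?thesis using that by (auto simp: ennreal_le_iff2)
    qed
    then have "\<forall>k. u k V \<le> ennreal C \<longrightarrow>
        real (Suc k) ^ m * measure ?N (tube_pairs A B V (real m / real (Suc k))) \<le> max C 0"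
      by blast
    from frequently_mono[OF this C] show ?case by (rule exI)
  qed
qed

lemma sets_grid_eq:
  fixes B :: "'a::euclidean_space set"
  assumes "finite B"
  shows "{x. grid B r x = q} \<in> sets borel"
proof (cases "q \<in> extensional B")
  case True
  then have "{x. grid B r x = q} = {x \<in> space borel. \<forall>b\<in>B. \<lfloor>(b \<bullet> x) / r\<rfloor> = q b}"
    by (auto simp: grid_def extensional_def fun_eq_iff)
  also have "\<dots> \<in> sets borel"
    using assms by measurable
  finally show ?thesis .
next
  case False
  then have "{x. grid B r x = q} = {}" by (auto simp: grid_def)
  then show ?thesis by simp
qed

text \<open>The scale must not exceed any radius: a smaller ball could still meet a cell and would
  not be paid for by its \<open>\<rho> ^ card B\<close>.\<close>

lemma grid_ball_union:
  assumes B: "finite B" "\<And>b. b \<in> B \<Longrightarrow> norm b = 1"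
    and F: "finite F" and r: "0 < r" "\<And>c \<rho>. (c, \<rho>) \<in> F \<Longrightarrow> r \<le> \<rho>"
  shows "finite (grid B r ` ball_union F)"
    "real (card (grid B r ` ball_union F)) \<le> (4 / r) ^ card B * (\<Sum>(c, \<rho>)\<in>F. \<rho> ^ card B)"
proof -
  have sub: "grid B r ` ball_union F \<subseteq> (\<Union>(c, \<rho>)\<in>F. grid B r ` cball c \<rho>)"
    unfolding ball_union_def by fastforce
  note g = card_grid_cball[OF B r(1)]
  have fin: "finite (\<Union>(c, \<rho>)\<in>F. grid B r ` cball c \<rho>)"
    using F g(1) r(2) by auto
  then show "finite (grid B r ` ball_union F)" using sub by (rule finite_subset[rotated])
  have "real (card (grid B r ` ball_union F)) \<le> real (card (\<Union>(c, \<rho>)\<in>F. grid B r ` cball c \<rho>))"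
    using card_mono[OF fin sub] by simp
  also have "\<dots> \<le> real (\<Sum>(c, \<rho>)\<in>F. card (grid B r ` cball c \<rho>))"
    using card_UN_le[OF F, of "\<lambda>(c, \<rho>). grid B r ` cball c \<rho>"]
    unfolding of_nat_le_iff by (simp add: case_prod_beta')
  also have "\<dots> = (\<Sum>(c, \<rho>)\<in>F. real (card (grid B r ` cball c \<rho>)))"
    by (simp add: case_prod_beta')
  also have "\<dots> \<le> (\<Sum>(c, \<rho>)\<in>F. (4 / r) ^ card B * \<rho> ^ card B)"
  proof (rule sum_mono, clarify)
    fix c \<rho> assume "(c, \<rho>) \<in> F"
    then show "real (card (grid B r ` cball c \<rho>)) \<le> (4 / r) ^ card B * \<rho> ^ card B"
      using g(2)[of \<rho> c] r(2) by (simp add: power_mult_distrib[symmetric])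
  qed
  also have "\<dots> = (4 / r) ^ card B * (\<Sum>(c, \<rho>)\<in>F. \<rho> ^ card B)"
    by (simp add: sum_distrib_left case_prod_beta')
  finally show "real (card (grid B r ` ball_union F)) \<le> (4 / r) ^ card B * (\<Sum>(c, \<rho>)\<in>F. \<rho> ^ card B)" .
qed

section \<open>Projections of separated pieces\<close>

text \<open>Cauchy--Schwarz over the grid cells meeting \<open>U\<close>: two points in the same cell form a pair
  counted by the product measure, and \<open>U\<close> meets few cells.\<close>

lemma measure_projection_grid_le:
  fixes \<mu> :: "'a::euclidean_space measure"
  assumes \<mu>: "finite_measure \<mu>" "sets \<mu> = sets borel"
    and E: "finite E" "pairwise orthogonal E" "\<And>b. b \<in> E \<Longrightarrow> norm b = 1" and V: "subspace V" "V = span E"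
    and A: "A \<in> sets borel" and B: "B \<in> sets borel" and Y: "Y \<in> sets borel"
    and r: "0 < r" and G: "finite (grid E r ` U)" and c: "0 \<le> c"
    and dom: "\<And>X. X \<in> sets borel \<Longrightarrow> X \<subseteq> Y \<Longrightarrow>
      measure \<mu> {x \<in> B. orth_proj V x \<in> X} \<le> c * measure \<mu> {x \<in> A. orth_proj V x \<in> X}"
  shows "(measure \<mu> {x \<in> B. orth_proj V x \<in> Y \<inter> U})\<^sup>2
    \<le> real (card (grid E r ` U)) * c * measure (\<mu> \<Otimes>\<^sub>M \<mu>) (tube_pairs A B V (real (card E) * r))"
proof -
  let ?N = "\<mu> \<Otimes>\<^sub>M \<mu>" and ?\<pi> = "orth_proj V"
  interpret \<mu>: finite_measure \<mu> by (rule \<mu>)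
  interpret N: finite_measure ?N by (intro finite_measure_pair_measure \<mu>)
  have sp: "space \<mu> = UNIV" using sets_eq_imp_space_eq[OF \<mu>(2)] by simp
  note [measurable_cong] = \<mu>(2)
  note [measurable] = A B Y
  have [measurable]: "?\<pi> \<in> borel \<rightarrow>\<^sub>M borel"
    by (intro borel_measurable_continuous_onI linear_continuous_on bounded_linear_orth_proj V)
  \<comment> \<open>The cells divide the projected points, not the points of \<open>A\<close> and
    \<open>B\<close> themselves.\<close>
  define Z where "Z q = Y \<inter> {x. grid E r x = q}" for q
  have Z[measurable]: "Z q \<in> sets borel" for q
    unfolding Z_def using sets_grid_eq[OF E(1)] by auto
  define AZ BZ where "AZ q = {x \<in> A. ?\<pi> x \<in> Z q}" and "BZ q = {x \<in> B. ?\<pi> x \<in> Z q}" for q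
  have AZ: "AZ q \<in> sets \<mu>" and BZ: "BZ q \<in> sets \<mu>" for q
  proof -
    have "{x \<in> space borel. x \<in> A \<and> ?\<pi> x \<in> Z q} \<in> sets borel"
      "{x \<in> space borel. x \<in> B \<and> ?\<pi> x \<in> Z q} \<in> sets borel" by measurable
    then show "AZ q \<in> sets \<mu>" "BZ q \<in> sets \<mu>" by (simp_all add: AZ_def BZ_def \<mu>(2))
  qed
  let ?G = "grid E r ` U" and ?b = "\<lambda>q. measure \<mu> (BZ q)"
  have T: "tube_pairs A B V t \<in> sets ?N" for t
  proof -
    have "{p \<in> space ?N. fst p \<in> A \<and> snd p \<in> B \<and> norm (?\<pi> (fst p - snd p)) \<le> t} \<in> sets ?N"
      by measurable
    then show ?thesis by (simp add: tube_pairs_def space_pair_measure sp)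
  qed
  have "measure \<mu> {x \<in> B. ?\<pi> x \<in> Y \<inter> U} \<le> measure \<mu> (\<Union>q\<in>?G. BZ q)"
    by (rule \<mu>.finite_measure_mono[OF _ sets.finite_UN[OF G BZ]]) (auto simp: BZ_def Z_def)
  also have "\<dots> \<le> (\<Sum>q\<in>?G. ?b q)"
    using G BZ by (intro \<mu>.finite_measure_subadditive_finite) auto
  finally have "(measure \<mu> {x \<in> B. ?\<pi> x \<in> Y \<inter> U})\<^sup>2 \<le> (\<Sum>q\<in>?G. ?b q)\<^sup>2"
    by (intro power_mono) auto
  also have "\<dots> \<le> real (card ?G) * (\<Sum>q\<in>?G. (?b q)\<^sup>2)"
    using Cauchy_Schwarz_ineq_sum[of "\<lambda>_. 1" ?b ?G] by simp
  also have "(\<Sum>q\<in>?G. (?b q)\<^sup>2) \<le> (\<Sum>q\<in>?G. c * measure ?N (AZ q \<times> BZ q))"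
  proof (rule sum_mono)
    fix q
    \<comment> \<open>Domination trades one of the two factors \<open>?b q\<close> for mass from
      \<open>A\<close>, so that the square becomes the product measure of a set of pairs.\<close>
    have "?b q \<le> c * measure \<mu> (AZ q)"
      unfolding AZ_def BZ_def by (rule dom[OF Z]) (auto simp: Z_def)
    then have "(?b q)\<^sup>2 \<le> c * measure \<mu> (AZ q) * ?b q"
      by (simp add: power2_eq_square mult_right_mono)
    also have "measure ?N (AZ q \<times> BZ q) = measure \<mu> (AZ q) * measure \<mu> (BZ q)"
      using \<mu>.emeasure_pair_measure_Times[OF AZ BZ, of q q]
      by (simp add: \<mu>.emeasure_eq_measure N.emeasure_eq_measure flip: ennreal_mult)
    then have "c * measure \<mu> (AZ q) * ?b q = c * measure ?N (AZ q \<times> BZ q)" by simp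
    finally show "(?b q)\<^sup>2 \<le> c * measure ?N (AZ q \<times> BZ q)" .
  qed
  also have "\<dots> = c * (\<Sum>q\<in>?G. measure ?N (AZ q \<times> BZ q))" by (simp add: sum_distrib_left)
  \<comment> \<open>Distinct cells give disjoint products, so no pair is counted twice.\<close>
  also have "(\<Sum>q\<in>?G. measure ?N (AZ q \<times> BZ q)) = measure ?N (\<Union>q\<in>?G. AZ q \<times> BZ q)"
    using AZ BZ G
    by (intro N.finite_measure_finite_Union[symmetric])
      (auto simp: disjoint_family_on_def AZ_def Z_def)
  also have "\<dots> \<le> measure ?N (tube_pairs A B V (real (card E) * r))"
  proof (intro N.finite_measure_mono T)
    show "(\<Union>q\<in>?G. AZ q \<times> BZ q) \<subseteq> tube_pairs A B V (real (card E) * r)"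
    proof clarify
      fix q x y assume xy: "x \<in> AZ q" "y \<in> BZ q"
      have "norm (orth_proj (span E) (?\<pi> x - ?\<pi> y)) \<le> real (card E) * r"
        by (rule grid_eq_imp_norm_orth_proj_le) (use E r xy in \<open>auto simp: AZ_def BZ_def Z_def\<close>)
      also have "orth_proj (span E) (?\<pi> x - ?\<pi> y) = ?\<pi> (x - y)"
        using orth_proj_fixes[OF V(1)] orth_proj_props(1)[OF V(1)]
        by (simp add: V(2)[symmetric] linear_diff[OF linear_orth_proj[OF V(1)]])
      finally show "(x, y) \<in> tube_pairs A B V (real (card E) * r)"
        using xy by (simp add: tube_pairs_def AZ_def BZ_def)
    qed
  qed
  finally show ?thesis
    using c by (simp add: mult_left_mono mult.assoc)
qed

text \<open>At scale \<open>1 / Suc k\<close> the family meets at most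
  \<open>(4 * Suc k) ^ m * e\<close> cells, while the close pairs have mass at most
  \<open>C / Suc k ^ m\<close>. In the product the scale cancels, and
  \<open>4 ^ m * c * C * e\<close> tends to 0 with \<open>e\<close>.\<close>

lemma projection_null_if_dominated:
  fixes \<mu> :: "'a::euclidean_space measure"
  assumes m: "0 < m" and V: "subspace V" "dim V = m"
    and \<mu>: "finite_measure \<mu>" "sets \<mu> = sets borel"
    and A: "A \<in> sets borel" and B: "B \<in> sets borel" and Y: "Y \<in> sets borel" and c: "0 \<le> c"
    and dom: "\<And>X. X \<in> sets borel \<Longrightarrow> X \<subseteq> Y \<Longrightarrow>
      measure \<mu> {x \<in> B. orth_proj V x \<in> X} \<le> c * measure \<mu> {x \<in> A. orth_proj V x \<in> X}"
    and cover: "\<And>k. \<exists>F\<in>small_families D m ((1/2) ^ k).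
          measure \<mu> {x. orth_proj V x \<notin> ball_union F} < (1/2) ^ k"
    and energy: "\<exists>\<^sub>F k in sequentially.
      real (Suc k) ^ m * measure (\<mu> \<Otimes>\<^sub>M \<mu>) (tube_pairs A B V (real m / real (Suc k))) \<le> C"
  shows "measure \<mu> {x \<in> B. orth_proj V x \<in> Y} = 0"
proof -
  let ?N = "\<mu> \<Otimes>\<^sub>M \<mu>" and ?\<pi> = "orth_proj V"
  interpret \<mu>: finite_measure \<mu> by (rule \<mu>)
  have sp: "space \<mu> = UNIV" using sets_eq_imp_space_eq[OF \<mu>(2)] by simp
  note [measurable_cong] = \<mu>(2)
  note [measurable] = B Y
  have [measurable]: "?\<pi> \<in> borel \<rightarrow>\<^sub>M borel"
    by (intro borel_measurable_continuous_onI linear_continuous_on bounded_linear_orth_proj V)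
  obtain E where E: "pairwise orthogonal E" "\<And>b. b \<in> E \<Longrightarrow> norm b = 1" "independent E"
      "card E = dim V" "span E = V"
    using orthonormal_basis_subspace[OF V(1)] by metis
  have fO: "finite E" using E(3) by (rule independent_imp_finite)
  define a where "a = measure \<mu> {x \<in> B. ?\<pi> x \<in> Y}"
  have C: "0 \<le> C"
  proof -
    obtain k where "real (Suc k) ^ m * measure ?N (tube_pairs A B V (real m / real (Suc k))) \<le> C"
      using frequently_ex[OF energy] by blast
    then show ?thesis by (rule order_trans[rotated]) simp
  qed
  have bound: "a\<^sup>2 \<le> 2 * (4 ^ m * c * C * e) + 2 * e\<^sup>2" if e: "e = (1/2) ^ n" for e :: real and n
  proof -
    obtain F where F: "F \<in> small_families D m e" "measure \<mu> {x. ?\<pi> x \<notin> ball_union F} < e"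
      using cover[of n] by (auto simp: e)
    note F' = F(1)[unfolded small_families_def]
    \<comment> \<open>Finiteness of \<open>F\<close> makes all sufficiently fine scales admissible,
      so one of the frequent good scales is among them.\<close>
    have "\<forall>\<^sub>F k in sequentially. \<forall>p\<in>F. 1 / real (Suc k) \<le> snd p"
    proof (rule eventually_ball_finite)
      show "finite F" using F' by simp
      show "\<forall>p\<in>F. \<forall>\<^sub>F k in sequentially. 1 / real (Suc k) \<le> snd p"
      proof
        fix p assume "p \<in> F"
        then have "0 < snd p" using F' by auto
        then have "\<forall>\<^sub>F k in sequentially. 1 / real (Suc k) < snd p"
          using LIMSEQ_inverse_real_of_nat by (intro order_tendstoD(2)[where y = 0]) (simp_all add: inverse_eq_divide)
        then show "\<forall>\<^sub>F k in sequentially. 1 / real (Suc k) \<le> snd p" by (rule eventually_mono) simp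
      qed
    qed
    then obtain k where
      k: "real (Suc k) ^ m * measure ?N (tube_pairs A B V (real m / real (Suc k))) \<le> C"
        "\<And>p. p \<in> F \<Longrightarrow> 1 / real (Suc k) \<le> snd p"
      using frequently_ex[OF frequently_eventually_frequently[OF energy]] by blast
    let ?r = "1 / real (Suc k)" and ?U = "ball_union F"
    let ?t = "measure ?N (tube_pairs A B V (real m / real (Suc k)))"
    have G: "finite (grid E ?r ` ?U)"
      "real (card (grid E ?r ` ?U)) \<le> (4 * real (Suc k)) ^ m * (\<Sum>(c, \<rho>)\<in>F. \<rho> ^ m)"
    proof -
      have r: "0 < ?r" "\<And>c \<rho>. (c, \<rho>) \<in> F \<Longrightarrow> ?r \<le> \<rho>" using k(2) by force+
      have "finite F" using F' by simp
      note g = grid_ball_union[OF fO E(2) this r]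
      show "finite (grid E ?r ` ?U)" by (rule g(1))
      show "real (card (grid E ?r ` ?U)) \<le> (4 * real (Suc k)) ^ m * (\<Sum>(c, \<rho>)\<in>F. \<rho> ^ m)"
        using g(2) E(4) V(2) by simp
    qed
    let ?b = "measure \<mu> {x \<in> B. ?\<pi> x \<in> Y \<inter> ?U}"
    have "?b\<^sup>2 \<le> real (card (grid E ?r ` ?U)) * c * measure ?N (tube_pairs A B V (real (card E) * ?r))"
      by (rule measure_projection_grid_le)
        (use \<mu> fO E V A B Y G(1) c dom in auto)
    also have "real (card E) * ?r = real m / real (Suc k)" using E(4) V(2) by simp
    also have "real (card (grid E ?r ` ?U)) * c * ?t \<le> ((4 * real (Suc k)) ^ m * e) * c * ?t"
    proof (intro mult_right_mono c measure_nonneg)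
      have "(4 * real (Suc k)) ^ m * (\<Sum>(c, \<rho>)\<in>F. \<rho> ^ m) \<le> (4 * real (Suc k)) ^ m * e"
        using F' by (intro mult_left_mono) auto
      then show "real (card (grid E ?r ` ?U)) \<le> (4 * real (Suc k)) ^ m * e" using G(2) by linarith
    qed
    also have "\<dots> = 4 ^ m * c * e * (real (Suc k) ^ m * ?t)"
      by (simp only: power_mult_distrib mult_ac)
    also have "\<dots> \<le> 4 ^ m * c * e * C"
      using k(1) c e by (intro mult_left_mono) auto
    finally have b: "?b\<^sup>2 \<le> 4 ^ m * c * C * e" by (simp add: mult_ac)
    have "a \<le> measure \<mu> ({x \<in> B. ?\<pi> x \<in> Y \<inter> ?U} \<union> {x. ?\<pi> x \<notin> ?U})"
    proof -
      have U[measurable]: "?U \<in> sets borel" by auto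
      have "{x \<in> space borel. (x \<in> B \<and> ?\<pi> x \<in> Y \<inter> ?U) \<or> ?\<pi> x \<notin> ?U} \<in> sets borel" by measurable
      then have "{x \<in> B. ?\<pi> x \<in> Y \<inter> ?U} \<union> {x. ?\<pi> x \<notin> ?U} \<in> sets \<mu>" by (simp add: \<mu>(2) Un_def)
      then show ?thesis unfolding a_def by (rule \<mu>.finite_measure_mono[rotated]) auto
    qed
    also have "\<dots> \<le> ?b + measure \<mu> {x. ?\<pi> x \<notin> ?U}"
    proof (rule measure_Un_le)
      have U[measurable]: "?U \<in> sets borel" by auto
      have "{x \<in> space borel. x \<in> B \<and> ?\<pi> x \<in> Y \<inter> ?U} \<in> sets borel"
        "{x \<in> space borel. ?\<pi> x \<notin> ?U} \<in> sets borel" by measurable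
      then show "{x \<in> B. ?\<pi> x \<in> Y \<inter> ?U} \<in> sets \<mu>" "{x. ?\<pi> x \<notin> ?U} \<in> sets \<mu>"
        by (simp_all add: \<mu>(2))
    qed
    also have "\<dots> \<le> ?b + e" using F(2) by simp
    finally have "a\<^sup>2 \<le> (?b + e)\<^sup>2" by (intro power_mono) (auto simp: a_def)
    also have "\<dots> \<le> 2 * ?b\<^sup>2 + 2 * e\<^sup>2"
      using sum_squares_bound[of ?b e] by (simp add: power2_sum)
    finally show ?thesis using b by linarith
  qed
  have "a\<^sup>2 \<le> 0"
  proof (rule LIMSEQ_le_const)
    have e0: "(\<lambda>n. (1/2 :: real) ^ n) \<longlonglongrightarrow> 0" by (intro LIMSEQ_power_zero) auto
    show "(\<lambda>n. 2 * (4 ^ m * c * C * (1/2) ^ n) + 2 * ((1/2) ^ n)\<^sup>2) \<longlonglongrightarrow> 0"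
      by (rule tendsto_eq_intros e0 refl)+ simp
    show "\<exists>N. \<forall>n\<ge>N. a\<^sup>2 \<le> 2 * (4 ^ m * c * C * (1/2) ^ n) + 2 * ((1/2) ^ n)\<^sup>2"
      using bound by blast
  qed
  then show ?thesis by (simp add: a_def)
qed

text \<open>The separating set is the union of Hahn sets \<open>Y j\<close> for the projection from
  \<open>B\<close> against \<open>j\<close> times the projection from \<open>A\<close>. Inside
  \<open>Y j\<close> domination makes the mass from \<open>B\<close> null; outside all of them
  \<open>j\<close> times the mass from \<open>A\<close> is bounded by the finite mass from
  \<open>B\<close> for every \<open>j\<close>, so it vanishes.\<close>

lemma projections_mutually_singular:
  fixes \<mu> :: "'a::euclidean_space measure"
  assumes m: "0 < m" and V: "subspace V" "dim V = m"
    and \<mu>: "finite_measure \<mu>" "sets \<mu> = sets borel"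
    and A: "A \<in> sets borel" and B: "B \<in> sets borel"
    and cover: "\<And>k. \<exists>F\<in>small_families D m ((1/2) ^ k).
          measure \<mu> {x. orth_proj V x \<notin> ball_union F} < (1/2) ^ k"
    and energy: "\<exists>C. \<exists>\<^sub>F k in sequentially.
      real (Suc k) ^ m * measure (\<mu> \<Otimes>\<^sub>M \<mu>) (tube_pairs A B V (real m / real (Suc k))) \<le> C"
  shows "\<exists>S\<in>sets borel. {x \<in> A. orth_proj V x \<notin> S} \<in> null_sets \<mu> \<and> {x \<in> B. orth_proj V x \<in> S} \<in> null_sets \<mu>"
proof -
  let ?\<pi> = "orth_proj V"
  interpret \<mu>: finite_measure \<mu> by (rule \<mu>)
  have sp: "space \<mu> = UNIV" using sets_eq_imp_space_eq[OF \<mu>(2)] by simp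
  note [measurable_cong] = \<mu>(2)
  note [measurable] = A B
  have \<pi>[measurable]: "?\<pi> \<in> borel \<rightarrow>\<^sub>M borel"
    by (intro borel_measurable_continuous_onI linear_continuous_on bounded_linear_orth_proj V)
  have M: "{x \<in> E. ?\<pi> x \<in> X} \<in> sets \<mu>" if [measurable]: "E \<in> sets borel" "X \<in> sets borel" for E X
  proof -
    have "{x \<in> space borel. x \<in> E \<and> ?\<pi> x \<in> X} \<in> sets borel" by measurable
    then show ?thesis by (simp add: \<mu>(2))
  qed
  define \<nu> where "\<nu> E = distr (density \<mu> (indicator E)) borel ?\<pi>" for E
  have \<nu>: "emeasure (\<nu> E) X = ennreal (measure \<mu> {x \<in> E. ?\<pi> x \<in> X})"
    if E: "E \<in> sets borel" and X: "X \<in> sets borel" for E X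
  proof -
    have pre: "?\<pi> -` X \<in> sets \<mu>"
      using M[of UNIV X] X by (simp add: vimage_def)
    have "emeasure (\<nu> E) X = emeasure (density \<mu> (indicator E)) (?\<pi> -` X)"
      unfolding \<nu>_def using X by (subst emeasure_distr) (auto simp: sp)
    also have "\<dots> = emeasure \<mu> (E \<inter> ?\<pi> -` X)"
      using E pre by (intro emeasure_restricted) (auto simp: \<mu>(2))
    also have "E \<inter> ?\<pi> -` X = {x \<in> E. ?\<pi> x \<in> X}" by auto
    finally show ?thesis by (simp add: \<mu>.emeasure_eq_measure)
  qed
  have fin: "finite_measure (scale_measure (ennreal c) (\<nu> E))" if "E \<in> sets borel" for c E
    by (rule finite_measureI) (use \<nu>[OF that, of UNIV] in \<open>simp add: \<nu>_def ennreal_mult_eq_top_iff space_scale_measure\<close>)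
  define P where "P j Y \<longleftrightarrow> Y \<in> sets borel \<and>
      (\<forall>X\<in>sets borel. X \<subseteq> Y \<longrightarrow> measure \<mu> {x \<in> B. ?\<pi> x \<in> X} \<le> real j * measure \<mu> {x \<in> A. ?\<pi> x \<in> X}) \<and>
      (\<forall>X\<in>sets borel. X \<inter> Y = {} \<longrightarrow> real j * measure \<mu> {x \<in> A. ?\<pi> x \<in> X} \<le> measure \<mu> {x \<in> B. ?\<pi> x \<in> X})"
    for j :: nat and Y
  have "\<exists>Y. P j Y" for j
  proof -
    let ?M = "scale_measure (ennreal (real j)) (\<nu> A)"
    have s: "sets (\<nu> B) = sets ?M" "sets ?M = sets borel" by (simp_all add: \<nu>_def)
    have eM: "emeasure ?M X = ennreal (real j * measure \<mu> {x \<in> A. ?\<pi> x \<in> X})" if "X \<in> sets borel" for X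
      by (simp add: \<nu>[OF A that] ennreal_mult)
    have "finite_measure (\<nu> B)" using fin[OF B, of 1] by simp
    from finite_unsigned_Hahn_decomposition[OF fin[OF A, of "real j"] this s(1), unfolded s(2)]
    obtain Y where Y: "Y \<in> sets borel"
      "\<And>X. X \<in> sets borel \<Longrightarrow> X \<subseteq> Y \<Longrightarrow> emeasure (\<nu> B) X \<le> emeasure ?M X"
      "\<And>X. X \<in> sets borel \<Longrightarrow> X \<inter> Y = {} \<Longrightarrow> emeasure ?M X \<le> emeasure (\<nu> B) X"
      by blast
    have "P j Y"
      unfolding P_def
    proof (intro conjI ballI impI Y(1))
      fix X :: "'a set" assume X: "X \<in> sets borel"
      show "measure \<mu> {x \<in> B. ?\<pi> x \<in> X} \<le> real j * measure \<mu> {x \<in> A. ?\<pi> x \<in> X}" if "X \<subseteq> Y"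
        using Y(2)[OF X that] unfolding \<nu>[OF B X] eM[OF X] by (subst (asm) ennreal_le_iff) auto
      show "real j * measure \<mu> {x \<in> A. ?\<pi> x \<in> X} \<le> measure \<mu> {x \<in> B. ?\<pi> x \<in> X}" if "X \<inter> Y = {}"
        using Y(3)[OF X that] unfolding \<nu>[OF B X] eM[OF X] by (subst (asm) ennreal_le_iff) auto
    qed
    then show ?thesis ..
  qed
  then obtain Y where PY: "\<And>j. P j (Y j)" by metis
  have Y: "\<And>j. Y j \<in> sets borel"
    "\<And>j X. X \<in> sets borel \<Longrightarrow> X \<subseteq> Y j \<Longrightarrow>
        measure \<mu> {x \<in> B. ?\<pi> x \<in> X} \<le> real j * measure \<mu> {x \<in> A. ?\<pi> x \<in> X}"
    "\<And>j X. X \<in> sets borel \<Longrightarrow> X \<inter> Y j = {} \<Longrightarrow>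
        real j * measure \<mu> {x \<in> A. ?\<pi> x \<in> X} \<le> measure \<mu> {x \<in> B. ?\<pi> x \<in> X}"
    using PY unfolding P_def by blast+
  obtain C where C: "\<exists>\<^sub>F k in sequentially.
      real (Suc k) ^ m * measure (\<mu> \<Otimes>\<^sub>M \<mu>) (tube_pairs A B V (real m / real (Suc k))) \<le> C"
    using energy by blast
  define S where "S = (\<Union>j. Y j)"
  have S: "S \<in> sets borel" using Y(1) by (auto simp: S_def)
  have "{x \<in> B. ?\<pi> x \<in> Y j} \<in> null_sets \<mu>" for j
  proof -
    have "measure \<mu> {x \<in> B. ?\<pi> x \<in> Y j} = 0"
      by (rule projection_null_if_dominated[OF m V \<mu> A B Y(1) _ Y(2) cover C]) auto
    then show ?thesis
      using M[OF B Y(1)] by (simp add: null_sets_def \<mu>.emeasure_eq_measure)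
  qed
  then have "(\<Union>j. {x \<in> B. ?\<pi> x \<in> Y j}) \<in> null_sets \<mu>" by auto
  also have "(\<Union>j. {x \<in> B. ?\<pi> x \<in> Y j}) = {x \<in> B. ?\<pi> x \<in> S}" by (auto simp: S_def)
  finally have BS: "{x \<in> B. ?\<pi> x \<in> S} \<in> null_sets \<mu>" .
  have S': "- S \<in> sets borel" using S by auto
  have "measure \<mu> {x \<in> A. ?\<pi> x \<in> - S} = 0"
  proof (rule ccontr)
    assume "measure \<mu> {x \<in> A. ?\<pi> x \<in> - S} \<noteq> 0"
    then have "0 < measure \<mu> {x \<in> A. ?\<pi> x \<in> - S}" by (simp add: zero_less_measure_iff)
    then obtain j :: nat where "measure \<mu> {x \<in> B. ?\<pi> x \<in> - S} < real j * measure \<mu> {x \<in> A. ?\<pi> x \<in> - S}"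
      using reals_Archimedean3 by blast
    moreover have "- S \<inter> Y j = {}" by (auto simp: S_def)
    ultimately show False using Y(3)[OF S', of j] by simp
  qed
  then have "{x \<in> A. ?\<pi> x \<notin> S} \<in> null_sets \<mu>"
    using M[OF A S'] by (simp add: null_sets_def \<mu>.emeasure_eq_measure)
  then show ?thesis using S BS by blast
qed

section \<open>Injectivity from countably many separated pairs\<close>

lemma ex_separating_balls:
  fixes x y :: "'a::metric_space"
  assumes "x \<noteq> y" and dense: "\<And>X::'a set. open X \<Longrightarrow> X \<noteq> {} \<Longrightarrow> \<exists>d\<in>D. d \<in> X"
  obtains c c' n where "c \<in> D" "c' \<in> D" "x \<in> ball c (1 / real (Suc n))" "y \<in> ball c' (1 / real (Suc n))"
    "2 / real (Suc n) < dist c c'"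
proof -
  \<comment> \<open>With \<open>r = 1 / Suc n\<close>, moving both points to centres costs less than
    \<open>2 * r\<close> of a distance above \<open>4 * r\<close>, which leaves more than the
    \<open>2 * r\<close> that keeps the balls at positive distance.\<close>
  have "0 < dist x y / 4" using assms(1) by simp
  then obtain n where n: "inverse (real (Suc n)) < dist x y / 4" using reals_Archimedean by blast
  obtain c c' where c: "c \<in> D" "c \<in> ball x (1 / real (Suc n))" "c' \<in> D" "c' \<in> ball y (1 / real (Suc n))"
    using dense[of "ball x (1 / real (Suc n))"] dense[of "ball y (1 / real (Suc n))"] by auto
  have "dist x y \<le> dist x c + dist c c' + dist c' y"
    using dist_triangle[of x y c] dist_triangle[of c y c'] by linarith
  moreover have "dist x c < 1 / real (Suc n)" "dist c' y < 1 / real (Suc n)"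
    using c by (auto simp: dist_commute)
  ultimately have "2 / real (Suc n) < dist c c'" using n by (simp add: inverse_eq_divide)
  then show thesis using c by (intro that[of c c' n]) (auto simp: dist_commute)
qed

text \<open>Two distinct points off the exceptional set lie in some pair of separated balls; the
  image of the first is in the corresponding \<open>S\<close>, that of the second is not.\<close>

lemma inj_on_full_measure:
  fixes \<mu> :: "'a::euclidean_space measure"
  assumes D: "countable D" and dense: "\<And>X::'a set. open X \<Longrightarrow> X \<noteq> {} \<Longrightarrow> \<exists>d\<in>D. d \<in> X"
    and \<mu>: "sets \<mu> = sets borel"
    and sep: "\<And>c c' n. c \<in> D \<Longrightarrow> c' \<in> D \<Longrightarrow> 2 / real (Suc n) < dist c c' \<Longrightarrow>
      \<exists>S. {x \<in> ball c (1 / real (Suc n)). f x \<notin> S} \<in> null_sets \<mu> \<and>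
          {x \<in> ball c' (1 / real (Suc n)). f x \<in> S} \<in> null_sets \<mu>"
  shows "\<exists>A\<in>sets \<mu>. emeasure \<mu> (space \<mu> - A) = 0 \<and> inj_on f A"
proof -
  define I where "I = {(c, c', n). c \<in> D \<and> c' \<in> D \<and> 2 / real (Suc n) < dist c c'}"
  have "countable (D \<times> D \<times> (UNIV :: nat set))" using D by (intro countable_SIGMA) auto
  then have I: "countable I" by (rule countable_subset[rotated]) (auto simp: I_def)
  have "\<forall>i\<in>I. \<exists>S. case i of (c, c', n) \<Rightarrow>
      {x \<in> ball c (1 / real (Suc n)). f x \<notin> S} \<in> null_sets \<mu> \<and>
      {x \<in> ball c' (1 / real (Suc n)). f x \<in> S} \<in> null_sets \<mu>"
    using sep unfolding I_def by fast
  from bchoice[OF this] obtain S where S: "\<And>c c' n. (c, c', n) \<in> I \<Longrightarrow>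
      {x \<in> ball c (1 / real (Suc n)). f x \<notin> S (c, c', n)} \<in> null_sets \<mu> \<and>
      {x \<in> ball c' (1 / real (Suc n)). f x \<in> S (c, c', n)} \<in> null_sets \<mu>" by fast
  define N where "N = (\<Union>(c, c', n)\<in>I. {x \<in> ball c (1 / real (Suc n)). f x \<notin> S (c, c', n)} \<union>
      {x \<in> ball c' (1 / real (Suc n)). f x \<in> S (c, c', n)})"
  have N: "N \<in> null_sets \<mu>"
    unfolding N_def using S by (intro null_sets_UN'[OF I]) (auto intro!: null_sets.Un)
  have "x = y" if xy: "x \<notin> N" "y \<notin> N" "f x = f y" for x y
  proof (rule ccontr)
    assume "x \<noteq> y"
    then obtain c c' n where c: "c \<in> D" "c' \<in> D" "x \<in> ball c (1 / real (Suc n))"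
      "y \<in> ball c' (1 / real (Suc n))" "2 / real (Suc n) < dist c c'"
      using ex_separating_balls[OF _ dense] by metis
    then have "(c, c', n) \<in> I" by (simp add: I_def)
    then have "f x \<in> S (c, c', n)" "f y \<notin> S (c, c', n)" using c xy(1,2) unfolding N_def by blast+
    then show False using xy(3) by simp
  qed
  then have "inj_on f (space \<mu> - N)" by (auto simp: inj_on_def)
  moreover have "space \<mu> - (space \<mu> - N) = N" using sets.sets_into_space[of N \<mu>] N by auto
  ultimately show ?thesis using N by (intro bexI[of _ "space \<mu> - N"]) auto
qed

theorem theorem1p3:
  fixes m :: nat
    and \<mu> :: "(real ^ 'n) measure"
    and \<gamma> :: "(real ^ 'n) set measure"
    and \<Sigma> :: "(real ^ 'n) set set"
  assumes "0 < m" and "m < CARD('n)"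
    and "finite_measure \<mu>" and "sets \<mu> = sets borel"
    and "grass_invariant_measure m \<gamma>"
    and "\<Sigma> \<in> sets (grass_borel m)"
  shows "(AE V in \<gamma>. V \<in> \<Sigma> \<longrightarrow>
            (\<exists>A\<in>sets \<mu>. emeasure \<mu> (space \<mu> - A) = 0 \<and> inj_on (orth_proj V) A)) \<or>
         emeasure \<gamma> {V \<in> \<Sigma>. proj_measure_ac m V \<mu> \<noteq> null_measure (restrict_space borel V)} > 0"
proof -
  note m = assms(1) and \<mu> = assms(3,4) and \<gamma> = assms(5)
  let ?P = "{V \<in> \<Sigma>. proj_measure_ac m V \<mu> \<noteq> null_measure (restrict_space borel V)}"
  have sets: "sets \<gamma> = sets (grass_borel m)" using \<gamma> by (simp add: grass_invariant_measure_def)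
  have sp: "space \<gamma> = grassmannian m" using sets_eq_imp_space_eq[OF sets] by simp
  have \<Sigma>: "\<Sigma> \<subseteq> grassmannian m" using sets.sets_into_space[OF assms(6)] by simp
  have "?P = \<Sigma> - {V \<in> grassmannian m. proj_measure_ac m V \<mu> = null_measure (restrict_space borel V)}"
    using \<Sigma> by auto
  \<comment> \<open>Needed to turn measure 0 of \<open>?P\<close> into an almost everywhere
    statement.\<close>
  then have P: "?P \<in> sets \<gamma>"
    using sets_proj_measure_ac_null[OF m \<mu>] assms(6) sets by auto
  have "AE V in \<gamma>. V \<in> \<Sigma> \<longrightarrow> (\<exists>A\<in>sets \<mu>. emeasure \<mu> (space \<mu> - A) = 0 \<and> inj_on (orth_proj V) A)"
    if null: "emeasure \<gamma> ?P = 0"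
  proof -
    obtain D :: "(real ^ 'n) set" where D: "countable D" "\<And>X. open X \<Longrightarrow> X \<noteq> {} \<Longrightarrow> \<exists>d\<in>D. d \<in> X"
      using countable_dense_setE by blast
    define I where "I = {(c, c', n). c \<in> D \<and> c' \<in> D \<and> 2 / real (Suc n) < dist c c'}"
    have "countable (D \<times> D \<times> (UNIV :: nat set))" using D(1) by (intro countable_SIGMA) auto
    then have I: "countable I" by (rule countable_subset[rotated]) (auto simp: I_def)
    have "AE V in \<gamma>. \<exists>C. \<exists>\<^sub>F k in sequentially. real (Suc k) ^ m * measure (\<mu> \<Otimes>\<^sub>M \<mu>)
        (tube_pairs (ball c (1 / real (Suc n))) (ball c' (1 / real (Suc n))) V (real m / real (Suc k))) \<le> C"
      if i: "(c, c', n) \<in> I" for c c' n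
    \<comment> \<open>The balls have radius \<open>1 / Suc n\<close> each, so points in them stay at
      least \<open>?d\<close> apart.\<close>
    proof (rule AE_tube_pairs_frequently_le[OF \<gamma> \<mu> _ _ m])
      let ?d = "dist c c' - 2 / real (Suc n)"
      show "0 < ?d" using i by (simp add: I_def)
      fix x y assume "x \<in> ball c (1 / real (Suc n))" "y \<in> ball c' (1 / real (Suc n))"
      moreover have "dist c c' \<le> dist c x + dist x y + dist y c'"
        using dist_triangle[of c c' x] dist_triangle[of x c' y] by linarith
      ultimately show "?d \<le> dist x y" by (simp add: dist_commute)
    qed auto
    \<comment> \<open>Countability of \<open>I\<close> gives one null set of subspaces that serves
      all pairs of balls at once.\<close>
    then have "AE V in \<gamma>. \<forall>i\<in>I. case i of (c, c', n) \<Rightarrow>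
        \<exists>C. \<exists>\<^sub>F k in sequentially. real (Suc k) ^ m * measure (\<mu> \<Otimes>\<^sub>M \<mu>)
        (tube_pairs (ball c (1 / real (Suc n))) (ball c' (1 / real (Suc n))) V (real m / real (Suc k))) \<le> C"
      by (subst AE_ball_countable[OF I]) auto
    moreover have "AE V in \<gamma>. V \<notin> ?P" using null P by (intro AE_not_in) auto
    ultimately show ?thesis
      using AE_space
    proof eventually_elim
      case (elim V)
      have V: "subspace V" "dim V = m" using elim(3) by (auto simp: sp grassmannian_def)
      show ?case
      proof
        assume "V \<in> \<Sigma>"
        then have "proj_measure_ac m V \<mu> = null_measure (restrict_space borel V)" using elim(2) by blast
        then have cover: "\<exists>F\<in>small_families D m ((1/2) ^ k).
            measure \<mu> {x. orth_proj V x \<notin> ball_union F} < (1/2) ^ k" for k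
          using proj_measure_ac_eq_null_iff[OF m V(1) \<mu> D(2)] by blast
        show "\<exists>A\<in>sets \<mu>. emeasure \<mu> (space \<mu> - A) = 0 \<and> inj_on (orth_proj V) A"
        proof (rule inj_on_full_measure[OF D \<mu>(2)])
          fix c c' n assume "c \<in> D" "c' \<in> D" "2 / real (Suc n) < dist c c'"
          then have "(c, c', n) \<in> I" by (simp add: I_def)
          then have "\<exists>C. \<exists>\<^sub>F k in sequentially. real (Suc k) ^ m * measure (\<mu> \<Otimes>\<^sub>M \<mu>)
              (tube_pairs (ball c (1 / real (Suc n))) (ball c' (1 / real (Suc n))) V (real m / real (Suc k))) \<le> C"
            using elim(1) by blast
          from projections_mutually_singular[OF m V \<mu> _ _ cover this]
          show "\<exists>S. {x \<in> ball c (1 / real (Suc n)). orth_proj V x \<notin> S} \<in> null_sets \<mu> \<and>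
              {x \<in> ball c' (1 / real (Suc n)). orth_proj V x \<in> S} \<in> null_sets \<mu>"
            by auto
        qed
      qed
    qed
  qed
  then show ?thesis by (cases "emeasure \<gamma> ?P = 0") (auto simp: zero_less_iff_neq_zero)
qed

end
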